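(* Let $R>0$, $\theta\in(0,\pi)$, let $\boldsymbol{\varphi}_0\in H^4(I_{\theta R})$ satisfy (A1), (A2) and (A3), let $\boldsymbol{x}$ be the unique time-global solution of problem (P), and let $\boldsymbol{\varphi}(s,t)=\boldsymbol{x}(s,t)-\boldsymbol{x}^R(s,t)$ (all as in the context). Then the following hold. (1) If $\boldsymbol{\varphi}_0$ is a constant vector, then $\boldsymbol{\varphi}(s,t)=\boldsymbol{\varphi}_0(s)$ for all $s\in I_{\theta R}$ and $t>0$. In particular, $\|\boldsymbol{\varphi}_{ss}(t)\|=0$ for all $t>0$. (2) If $\boldsymbol{\varphi}_0$ is not a constant vector, then $\|\boldsymbol{\varphi}_{0ss}\|>0$ and $$\|\boldsymbol{\varphi}_{ss}(t)\|\ge\Big(1-\frac{\theta^2}{\pi^2}\Big)^{\frac12}\|\boldsymbol{\varphi}_{0ss}\|\qquad\text{for all }t>0.$$ In other words, $\|\boldsymbol{\varphi}_{ss}(t)\|$ is either $0$ for all $t>0$ or strictly positive for all $t>0$. Consequently the arc-shaped filament is not asymptotically stable under any non-zero perturbation: if $\boldsymbol{\varphi}_0\ne\boldsymbol{0}$, then $\boldsymbol{\varphi}(\cdot,t)$ does not converge to $\boldsymbol{0}$ in $H^2(I_{\theta R})$ as $t\to\infty$.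
   Context: Notation. Subscripts $s,t$ denote differentiation; $\times$ and $\cdot$ are the cross and inner products in $\mathbf{R}^3$; for $\ell>0$, $I_\ell=(0,\ell)$. $H^m$ is the usual $L^2$-based Sobolev space and $\|\cdot\|$ is the $L^2$-norm over $I_{\theta R}$ in the variable $s$; a vector-valued function belongs to a function space if each component does. Values of functions and their derivatives at endpoints are traces. Given $R>0$ and $\theta$, put $L=\theta R$, $\boldsymbol{e}_2={}^t(0,1,0)$, $\boldsymbol{b}={}^t(-\sin\theta,\cos\theta,0)$, $$\boldsymbol{x}^R(s,t)={}^t\big(R\cos(\tfrac sR),R\sin(\tfrac sR),\tfrac tR\big),\qquad \boldsymbol{x}^R_0(s)={}^t\big(R\cos(\tfrac sR),R\sin(\tfrac sR),0\big)$$ (the arc-shaped filament and its initial state). Problem (P), for the unknown $\boldsymbol{x}(s,t)\in\mathbf{R}^3$: $$\boldsymbol{x}_t=\boldsymbol{x}_s\times\boldsymbol{x}_{ss}\ (s\in I_{\theta R},\,t>0),\quad \boldsymbol{x}(s,0)=\boldsymbol{x}^R_0(s)+\boldsymbol{\varphi}_0(s)\ (s\in I_{\theta R}),\quad \boldsymbol{x}_s(0,t)=\boldsymbol{e}_2,\ \boldsymbol{x}_s(\theta R,t)=\boldsymbol{b}\ (t>0).$$ For $\boldsymbol{\varphi}_0$ satisfying (A1)–(A3) below it has a unique time-global solution with $|\boldsymbol{x}_s|=1$, $\boldsymbol{x}\in\bigcap_{j=0}^{2}C^j([0,\infty);H^{4-2j}(I_{\theta R}))$ and $\boldsymbol{x}_s\in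 L^\infty(0,\infty;H^3(I_{\theta R}))$. Assumptions on $\boldsymbol{\varphi}_0\in H^4(I_{\theta R})$: (A1) $|\boldsymbol{x}^R_{0s}(s)+\boldsymbol{\varphi}_{0s}(s)|=1$ for all $s\in I_{\theta R}$. (A2) $\boldsymbol{x}_0:=\boldsymbol{x}^R_0+\boldsymbol{\varphi}_0$ satisfies the compatibility conditions up to order $1$: $\boldsymbol{x}_{0s}(0)=\boldsymbol{e}_2$, $\boldsymbol{x}_{0s}(\theta R)=\boldsymbol{b}$, and $\boldsymbol{x}_{0s}\times\boldsymbol{x}_{0sss}=\boldsymbol{0}$ at $s=0$ and at $s=\theta R$. (A3) $\boldsymbol{e}_2\cdot\boldsymbol{\varphi}_0(0)=\boldsymbol{b}\cdot\boldsymbol{\varphi}_0(\theta R)=0$. *)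

theory Defs
  imports "HOL-Analysis.Analysis"
begin

section \<open>Sobolev spaces on an interval\<close>

text \<open>
  Elements of \<open>L\<^sup>2\<close> and \<open>H\<^sup>m\<close> over \<open>(0,l)\<close> are represented by functions on the real line;
  functions that agree almost everywhere on \<open>(0,l)\<close> represent the same element, and every notion
  below depends on the represented element only. Integrating a vector-valued function against
  scalar test functions is the same as working componentwise.
\<close>

definition L2 :: "real \<Rightarrow> (real \<Rightarrow> 'a::euclidean_space) set" where
  "L2 l = {f. f \<in> borel_measurable (lebesgue_on {0<..<l}) \<and>
              integrable (lebesgue_on {0<..<l}) (\<lambda>s. (norm (f s))\<^sup>2)}"

definition L2norm :: "real \<Rightarrow> (real \<Rightarrow> 'a::euclidean_space) \<Rightarrow> real" where
  "L2norm l f = sqrt (integral\<^sup>L (lebesgue_on {0<..<l}) (\<lambda>s. (norm (f s))\<^sup>2))"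

definition test_functions :: "real \<Rightarrow> (real \<Rightarrow> real) set" where
  "test_functions l = {\<eta>. (\<forall>k. (deriv ^^ k) \<eta> differentiable_on UNIV) \<and>
                          (\<exists>K. compact K \<and> K \<subseteq> {0<..<l} \<and> (\<forall>s. s \<notin> K \<longrightarrow> \<eta> s = 0))}"

definition has_weak_deriv ::
    "real \<Rightarrow> nat \<Rightarrow> (real \<Rightarrow> 'a::euclidean_space) \<Rightarrow> (real \<Rightarrow> 'a) \<Rightarrow> bool" where
  "has_weak_deriv l k f g \<longleftrightarrow>
     (\<forall>\<eta>\<in>test_functions l.
        integral\<^sup>L (lebesgue_on {0<..<l}) (\<lambda>s. (deriv ^^ k) \<eta> s *\<^sub>R f s) =
        (- 1) ^ k *\<^sub>R integral\<^sup>L (lebesgue_on {0<..<l}) (\<lambda>s. \<eta> s *\<^sub>R g s))"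

text \<open>The weak derivative is unique up to null sets only, hence the choice of a representative.\<close>

definition wderiv :: "real \<Rightarrow> nat \<Rightarrow> (real \<Rightarrow> 'a::euclidean_space) \<Rightarrow> real \<Rightarrow> 'a" where
  "wderiv l k f = (SOME g. g \<in> L2 l \<and> has_weak_deriv l k f g)"

definition Hs :: "real \<Rightarrow> nat \<Rightarrow> (real \<Rightarrow> 'a::euclidean_space) set" where
  "Hs l m = {f. f \<in> L2 l \<and> (\<forall>k\<le>m. \<exists>g\<in>L2 l. has_weak_deriv l k f g)}"

definition Hnorm :: "real \<Rightarrow> nat \<Rightarrow> (real \<Rightarrow> 'a::euclidean_space) \<Rightarrow> real" where
  "Hnorm l m f = sqrt (\<Sum>k\<le>m. (L2norm l (wderiv l k f))\<^sup>2)"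

text \<open>
  The value at \<open>a \<in> [0,l]\<close> of the continuous representative, which every element of \<open>H\<^sup>1\<close> has;
  for \<open>a = 0\<close> and \<open>a = l\<close> this is the trace.
\<close>

definition ptval :: "real \<Rightarrow> (real \<Rightarrow> 'a::euclidean_space) \<Rightarrow> real \<Rightarrow> 'a" where
  "ptval l f a = (THE v. \<exists>g. continuous_on {0..l} g \<and>
                             (AE s in lebesgue_on {0<..<l}. g s = f s) \<and> g a = v)"

abbreviation dval :: "real \<Rightarrow> nat \<Rightarrow> (real \<Rightarrow> 'a::euclidean_space) \<Rightarrow> real \<Rightarrow> 'a" where
  "dval l k f a \<equiv> ptval l (wderiv l k f) a"


section \<open>Functions of time with values in a Sobolev space\<close>

text \<open>A function \<open>u(s,t)\<close> is written in the curried form \<open>u t s\<close>.\<close>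

definition time_cont :: "real \<Rightarrow> nat \<Rightarrow> (real \<Rightarrow> real \<Rightarrow> 'a::euclidean_space) \<Rightarrow> bool" where
  "time_cont l m u \<longleftrightarrow>
     (\<forall>t\<ge>0. u t \<in> Hs l m) \<and>
     (\<forall>t\<ge>0. ((\<lambda>r. Hnorm l m (\<lambda>s. u r s - u t s)) \<longlongrightarrow> 0) (at t within {0..}))"

text \<open>The derivative at time \<open>t \<ge> 0\<close> in the norm of \<open>H\<^sup>m\<close>, one-sided at \<open>t = 0\<close>.\<close>

definition has_time_deriv ::
    "real \<Rightarrow> nat \<Rightarrow> (real \<Rightarrow> real \<Rightarrow> 'a::euclidean_space) \<Rightarrow> (real \<Rightarrow> 'a) \<Rightarrow> real \<Rightarrow> bool" where
  "has_time_deriv l m u w t \<longleftrightarrow>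
     (\<forall>r\<ge>0. u r \<in> Hs l m) \<and> w \<in> Hs l m \<and>
     ((\<lambda>h. Hnorm l m (\<lambda>s. (u (t + h) s - u t s) /\<^sub>R h - w s)) \<longlongrightarrow> 0) (at 0 within {- t..})"

primrec time_Ck :: "real \<Rightarrow> nat \<Rightarrow> nat \<Rightarrow> (real \<Rightarrow> real \<Rightarrow> 'a::euclidean_space) \<Rightarrow> bool" where
  "time_Ck l m 0 u \<longleftrightarrow> time_cont l m u"
| "time_Ck l m (Suc j) u \<longleftrightarrow>
     time_cont l m u \<and> (\<exists>v. (\<forall>t\<ge>0. has_time_deriv l m u (v t) t) \<and> time_Ck l m j v)"

text \<open>
  The time derivative is taken in \<open>L\<^sup>2 = H\<^sup>0\<close>. A derivative in the norm of \<open>H\<^sup>m\<close> is also one in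
  the norm of \<open>L\<^sup>2\<close>, so the two agree when the former exists.
\<close>

definition tderiv :: "real \<Rightarrow> (real \<Rightarrow> real \<Rightarrow> 'a::euclidean_space) \<Rightarrow> real \<Rightarrow> real \<Rightarrow> 'a" where
  "tderiv l u t = (SOME w. has_time_deriv l 0 u w t)"

definition strongly_measurable ::
    "real \<Rightarrow> nat \<Rightarrow> (real \<Rightarrow> real \<Rightarrow> 'a::euclidean_space) \<Rightarrow> bool" where
  "strongly_measurable l m u \<longleftrightarrow>
     (\<exists>U :: nat \<Rightarrow> real \<Rightarrow> real \<Rightarrow> 'a.
        (\<forall>n. finite (U n ` {0<..}) \<and> U n ` {0<..} \<subseteq> Hs l m \<and>
             (\<forall>f. {t \<in> {0<..}. U n t = f} \<in> sets lebesgue)) \<and>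
        (AE t in lebesgue_on {0<..}. (\<lambda>n. Hnorm l m (\<lambda>s. U n t s - u t s)) \<longlonglongrightarrow> 0))"

definition time_Linf :: "real \<Rightarrow> nat \<Rightarrow> (real \<Rightarrow> real \<Rightarrow> 'a::euclidean_space) \<Rightarrow> bool" where
  "time_Linf l m u \<longleftrightarrow>
     strongly_measurable l m u \<and>
     (\<exists>C. AE t in lebesgue_on {0<..}. u t \<in> Hs l m \<and> Hnorm l m (u t) \<le> C)"


section \<open>The arc-shaped filament and its perturbation\<close>

definition e2 :: "real^3" where
  "e2 = vector [0, 1, 0]"

definition bvec :: "real \<Rightarrow> real^3" where
  "bvec \<theta> = vector [- sin \<theta>, cos \<theta>, 0]"

definition arc_filament :: "real \<Rightarrow> real \<Rightarrow> real \<Rightarrow> real^3" where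
  "arc_filament R t s = vector [R * cos (s / R), R * sin (s / R), t / R]"

definition arc_filament0 :: "real \<Rightarrow> real \<Rightarrow> real^3" where
  "arc_filament0 R s = vector [R * cos (s / R), R * sin (s / R), 0]"

definition unit_speed_datum :: "real \<Rightarrow> real \<Rightarrow> (real \<Rightarrow> real^3) \<Rightarrow> bool" where
  "unit_speed_datum R \<theta> \<phi>0 \<longleftrightarrow>
     (\<forall>s\<in>{0<..<\<theta> * R}. norm (dval (\<theta> * R) 1 (arc_filament0 R) s + dval (\<theta> * R) 1 \<phi>0 s) = 1)"

definition compatible_datum :: "real \<Rightarrow> real \<Rightarrow> (real \<Rightarrow> real^3) \<Rightarrow> bool" where
  "compatible_datum R \<theta> \<phi>0 \<longleftrightarrow>
     (let l = \<theta> * R; x0 = (\<lambda>s. arc_filament0 R s + \<phi>0 s) in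
        dval l 1 x0 0 = e2 \<and> dval l 1 x0 l = bvec \<theta> \<and>
        cross3 (dval l 1 x0 0) (dval l 3 x0 0) = 0 \<and>
        cross3 (dval l 1 x0 l) (dval l 3 x0 l) = 0)"

definition normal_datum :: "real \<Rightarrow> real \<Rightarrow> (real \<Rightarrow> real^3) \<Rightarrow> bool" where
  "normal_datum R \<theta> \<phi>0 \<longleftrightarrow>
     e2 \<bullet> ptval (\<theta> * R) \<phi>0 0 = 0 \<and> bvec \<theta> \<bullet> ptval (\<theta> * R) \<phi>0 (\<theta> * R) = 0"

definition solves_P :: "real \<Rightarrow> real \<Rightarrow> (real \<Rightarrow> real^3) \<Rightarrow> (real \<Rightarrow> real \<Rightarrow> real^3) \<Rightarrow> bool" where
  "solves_P R \<theta> \<phi>0 x \<longleftrightarrow>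
     (let l = \<theta> * R in
        (\<forall>t>0. \<forall>s\<in>{0<..<l}.
           ptval l (tderiv l x t) s = cross3 (dval l 1 (x t) s) (dval l 2 (x t) s)) \<and>
        (\<forall>s\<in>{0<..<l}. ptval l (x 0) s = arc_filament0 R s + ptval l \<phi>0 s) \<and>
        (\<forall>t>0. dval l 1 (x t) 0 = e2 \<and> dval l 1 (x t) l = bvec \<theta>))"

definition solution_class :: "real \<Rightarrow> (real \<Rightarrow> real \<Rightarrow> real^3) \<Rightarrow> bool" where
  "solution_class l x \<longleftrightarrow>
     (\<forall>t>0. \<forall>s\<in>{0<..<l}. norm (dval l 1 (x t) s) = 1) \<and>
     (\<forall>j\<le>2. time_Ck l (4 - 2 * j) j x) \<and>
     time_Linf l 3 (\<lambda>t. wderiv l 1 (x t))"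

end

theory Submission
  imports Defs
begin

text \<open>
  Write \<open>T = x\<^sub>s\<close> for the tangent of the filament, \<open>\<tau>\<close> for that of the arc and \<open>l = \<theta> R\<close>; then
  \<open>\<phi>\<^sub>s = T - \<tau>\<close>, and this vanishes at both ends. Two facts carry the theorem.

  The bending energy \<open>\<parallel>x\<^sub>s\<^sub>s\<parallel>\<^sup>2\<close> is conserved (\<open>energy_conserved\<close>): the equation gives
  \<open>T\<^sub>t = T \<times> T\<^sub>s\<^sub>s\<close>, which is orthogonal to \<open>T\<^sub>s\<^sub>s\<close>, while \<open>T\<close> is prescribed at the ends. Expanding
  the squares with \<open>|T| = |\<tau>| = 1\<close> and \<open>\<tau>\<^sub>s\<^sub>s = - \<tau> / R\<^sup>2\<close> turns the energy into
  \<open>\<parallel>\<phi>\<^sub>s\<^sub>s\<parallel>\<^sup>2 - \<parallel>\<phi>\<^sub>s\<parallel>\<^sup>2 / R\<^sup>2\<close> plus a constant (\<open>excess_energy\<close>), so that this difference does not depend on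
  time either. Secondly, the Wirtinger inequality on \<open>(0,l)\<close> for functions vanishing at the ends
  (\<open>wirtinger\<close>) says that \<open>\<parallel>\<phi>\<^sub>s\<parallel>\<^sup>2 / R\<^sup>2 \<le> (\<theta>\<^sup>2 / \<pi>\<^sup>2) \<parallel>\<phi>\<^sub>s\<^sub>s\<parallel>\<^sup>2\<close>. Hence
  \<open>\<parallel>\<phi>\<^sub>s\<^sub>s(t)\<parallel>\<^sup>2 \<ge> \<parallel>\<phi>\<^sub>s\<^sub>s(t)\<parallel>\<^sup>2 - \<parallel>\<phi>\<^sub>s(t)\<parallel>\<^sup>2 / R\<^sup>2 = \<parallel>\<phi>\<^sub>0\<^sub>s\<^sub>s\<parallel>\<^sup>2 - \<parallel>\<phi>\<^sub>0\<^sub>s\<parallel>\<^sup>2 / R\<^sup>2 \<ge> (1 - \<theta>\<^sup>2 / \<pi>\<^sup>2) \<parallel>\<phi>\<^sub>0\<^sub>s\<^sub>s\<parallel>\<^sup>2\<close>,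
  and the same chain with the times \<open>0\<close> and \<open>t\<close> exchanged bounds \<open>\<parallel>\<phi>\<^sub>s\<^sub>s(t)\<parallel>\<close> by a multiple of \<open>\<parallel>\<phi>\<^sub>0\<^sub>s\<^sub>s\<parallel>\<close>. If \<open>\<phi>\<^sub>0\<close> is
  constant, both are \<open>0\<close>, so the tangent of \<open>x\<close> stays \<open>\<tau>\<close>; the equation then reads
  \<open>x\<^sub>t = \<tau> \<times> \<tau>\<^sub>s\<close>, which is the constant velocity of the arc itself, and \<open>\<phi>\<close> does not move.

  What remains is to make these computations legitimate for elements of Sobolev spaces that are
  given by weak derivatives only. Smooth bump functions that converge to indicators of intervals
  yield the lemma of du Bois-Reymond, and from it an element of \<open>H\<^sup>m\<close> is represented by a function
  with \<open>m - 1\<close> continuous derivatives (\<open>dval_continuous\<close>, \<open>dval_has_vector_derivative\<close>). By the Sobolev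
  inequality (\<open>sobolev_embedding\<close>) limits in time in the norm of \<open>H\<^sup>m\<close> are uniform limits of these
  derivatives. After that everything is calculus with continuous functions: the energies at two
  times are compared by one integration by parts (\<open>energy_difference\<close>), which involves only \<open>x\<^sub>s\<close>
  and \<open>x\<^sub>s\<^sub>s\<^sub>s\<close>, and these are continuous for \<open>x(t) \<in> H\<^sup>4\<close>.
\<close>

section \<open>Smooth bump functions on an interval\<close>

text \<open>
  The classical function that is flat at \<open>0\<close>, \<open>exp (- c / x)\<close>. The powers of \<open>1 / x\<close> are carried along
  because they are what differentiation produces.
\<close>

definition flat :: "real \<Rightarrow> nat \<Rightarrow> real \<Rightarrow> real" where
  "flat c i x = (if x > 0 then (1 / x) ^ i * exp (- c / x) else 0)"

text \<open>
  In terms of \<open>y = c / x\<close>, which tends to infinity, this is the decay of \<open>y ^ i / exp y\<close>.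
\<close>

lemma flat_tendsto_0:
  assumes "c > 0" shows "((\<lambda>x. flat c i x) \<longlongrightarrow> 0) (at 0)"
proof -
  have "filterlim (\<lambda>x. c * inverse x) at_top (at_right 0)"
    using filterlim_tendsto_pos_mult_at_top[OF tendsto_const assms filterlim_inverse_at_top_right] .
  from filterlim_compose[OF tendsto_power_div_exp_0 this, of i]
  have "((\<lambda>x. (1 / c) ^ i * ((c * inverse x) ^ i / exp (c * inverse x))) \<longlongrightarrow> (1 / c) ^ i * 0) (at_right 0)"
    by (intro tendsto_mult tendsto_const)
  moreover have "\<forall>\<^sub>F x in at_right 0. (1 / c) ^ i * ((c * inverse x) ^ i / exp (c * inverse x)) = flat c i x"
  proof -
    have "(1 / c) ^ i * ((c * inverse x) ^ i / exp (c * inverse x)) = flat c i x" if "x > 0" for x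
    proof -
      have "(1 / c) ^ i * (c * inverse x) ^ i = (1 / x) ^ i"
        using assms by (subst power_mult_distrib[symmetric]) (simp add: inverse_eq_divide)
      then show ?thesis
        using that by (simp add: flat_def exp_minus divide_inverse mult.assoc[symmetric])
    qed
    then show ?thesis
      by (auto simp: eventually_at_filter)
  qed
  ultimately have R: "((\<lambda>x. flat c i x) \<longlongrightarrow> 0) (at_right 0)"
    by (simp add: tendsto_cong)
  have "\<forall>\<^sub>F x in at_left 0. 0 = flat c i x"
    by (auto simp: eventually_at_filter flat_def)
  then have "((\<lambda>x. flat c i x) \<longlongrightarrow> 0) (at_left 0)"
    by (rule Lim_transform_eventually[rotated]) simp
  with R show ?thesis
    by (simp add: filterlim_split_at)
qed

lemma flat_has_real_derivative:
  assumes "c > 0"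
  shows "(flat c i has_real_derivative c * flat c (i + 2) x - real i * flat c (i + 1) x) (at x)"
proof -
  consider "x > 0" | "x < 0" | "x = 0" by linarith
  then show ?thesis
  proof cases
    case 1
    have "((\<lambda>x. (1 / x) ^ i * exp (- c / x)) has_real_derivative
          c * flat c (i + 2) x - real i * flat c (i + 1) x) (at x)"
    proof -
      have inv: "((\<lambda>x. 1 / x) has_real_derivative - ((1 / x) ^ 2)) (at x)"
        using 1 by (auto intro!: derivative_eq_intros simp: power2_eq_square field_simps)
      have "((\<lambda>x. (1 / x) ^ i) has_real_derivative - real i * (1 / x) ^ (i + 1)) (at x)"
        by (rule DERIV_cong[OF DERIV_power[OF inv, of i]]) (use 1 in \<open>cases i; auto simp: power2_eq_square field_simps\<close>)
      moreover have "((\<lambda>x. exp (- c / x)) has_real_derivative exp (- c / x) * (c * (1 / x) ^ 2)) (at x)"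
        using 1 by (auto intro!: derivative_eq_intros simp: power2_eq_square field_simps)
      ultimately have "((\<lambda>x. (1 / x) ^ i * exp (- c / x)) has_real_derivative
          - real i * (1 / x) ^ (i + 1) * exp (- c / x) + exp (- c / x) * (c * (1 / x) ^ 2) * (1 / x) ^ i) (at x)"
        by (rule DERIV_mult)
      then show ?thesis
        using 1 by (simp add: flat_def power_add power2_eq_square mult_ac)
    qed
    then show ?thesis
      by (rule has_field_derivative_transform_within_open[of _ _ _ "{0<..}"]) (use 1 in \<open>auto simp: flat_def\<close>)
  next
    case 2
    have "((\<lambda>x. 0) has_real_derivative c * flat c (i + 2) x - real i * flat c (i + 1) x) (at x)"
      using 2 by (simp add: flat_def)
    then show ?thesis
      by (rule has_field_derivative_transform_within_open[of _ _ _ "{..<0}"]) (use 2 in \<open>auto simp: flat_def\<close>)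
  next
    case 3
    have "\<forall>\<^sub>F x in at 0. flat c (i + 1) x = (flat c i x - flat c i 0) / (x - 0)"
      by (auto simp: eventually_at_filter flat_def)
    with flat_tendsto_0[OF assms, of "i + 1"]
    have "((\<lambda>x. (flat c i x - flat c i 0) / (x - 0)) \<longlongrightarrow> 0) (at 0)"
      by (rule Lim_transform_eventually)
    then have "(flat c i has_real_derivative 0) (at 0)"
      by (simp add: has_field_derivative_iff)
    then show ?thesis
      using 3 by (simp add: flat_def)
  qed
qed

text \<open>
  The derivatives of a product of two flat functions, one at each end of \<open>(a,b)\<close>, need not be
  computed: it is enough that they all belong to one algebra of differentiable functions that is
  closed under differentiation.
\<close>

inductive_set flat_algebra :: "real \<Rightarrow> real \<Rightarrow> real \<Rightarrow> (real \<Rightarrow> real) set" for c a b where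
  left: "(\<lambda>x. flat c i (x - a)) \<in> flat_algebra c a b"
| right: "(\<lambda>x. flat c i (b - x)) \<in> flat_algebra c a b"
| add: "f \<in> flat_algebra c a b \<Longrightarrow> g \<in> flat_algebra c a b \<Longrightarrow> (\<lambda>x. f x + g x) \<in> flat_algebra c a b"
| mult: "f \<in> flat_algebra c a b \<Longrightarrow> g \<in> flat_algebra c a b \<Longrightarrow> (\<lambda>x. f x * g x) \<in> flat_algebra c a b"
| scale: "f \<in> flat_algebra c a b \<Longrightarrow> (\<lambda>x. r * f x) \<in> flat_algebra c a b"

lemma flat_algebra_derivative:
  assumes "c > 0" "f \<in> flat_algebra c a b"
  shows "\<exists>f'\<in>flat_algebra c a b. \<forall>x. (f has_real_derivative f' x) (at x)"
  using assms(2)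
proof induction
  case (left i)
  have "(\<lambda>x. c * flat c (i + 2) (x - a) + (- real i) * flat c (i + 1) (x - a)) \<in> flat_algebra c a b"
    by (intro flat_algebra.intros)
  moreover have "((\<lambda>x. flat c i (x - a)) has_real_derivative
      c * flat c (i + 2) (x - a) + (- real i) * flat c (i + 1) (x - a)) (at x)" for x
    by (rule DERIV_cong[OF DERIV_chain2[OF flat_has_real_derivative[OF assms(1)]]])
       (auto intro!: derivative_eq_intros)
  ultimately show ?case by (intro bexI[rotated] allI)
next
  case (right i)
  have "(\<lambda>x. (- c) * flat c (i + 2) (b - x) + real i * flat c (i + 1) (b - x)) \<in> flat_algebra c a b"
    by (intro flat_algebra.intros)
  moreover have "((\<lambda>x. flat c i (b - x)) has_real_derivative
      (- c) * flat c (i + 2) (b - x) + real i * flat c (i + 1) (b - x)) (at x)" for x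
    by (rule DERIV_cong[OF DERIV_chain2[OF flat_has_real_derivative[OF assms(1)]]])
       (auto intro!: derivative_eq_intros)
  ultimately show ?case by (intro bexI[rotated] allI)
next
  case (add f g)
  then obtain f' g' where "f' \<in> flat_algebra c a b" "g' \<in> flat_algebra c a b"
    "\<And>x. (f has_real_derivative f' x) (at x)" "\<And>x. (g has_real_derivative g' x) (at x)" by blast
  then show ?case
    by (intro bexI[of _ "\<lambda>x. f' x + g' x"]) (auto intro!: flat_algebra.intros derivative_eq_intros)
next
  case (mult f g)
  then obtain f' g' where *: "f' \<in> flat_algebra c a b" "g' \<in> flat_algebra c a b"
    "\<And>x. (f has_real_derivative f' x) (at x)" "\<And>x. (g has_real_derivative g' x) (at x)" by blast
  then show ?case
    using mult.hyps
    by (intro bexI[of _ "\<lambda>x. f' x * g x + g' x * f x"] flat_algebra.add flat_algebra.mult allI DERIV_mult) auto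
next
  case (scale f r)
  then obtain f' where "f' \<in> flat_algebra c a b"
    "\<And>x. (f has_real_derivative f' x) (at x)" by blast
  then show ?case
    by (intro bexI[of _ "\<lambda>x. r * f' x"]) (auto intro!: flat_algebra.intros derivative_eq_intros)
qed

lemma flat_algebra_smooth:
  assumes "c > 0" "f \<in> flat_algebra c a b"
  shows "(deriv ^^ k) f \<in> flat_algebra c a b" "(deriv ^^ k) f differentiable_on UNIV"
proof -
  have D: "deriv f \<in> flat_algebra c a b" if f: "f \<in> flat_algebra c a b" for f
  proof -
    obtain f' where f': "f' \<in> flat_algebra c a b" "\<And>x. (f has_real_derivative f' x) (at x)"
      using flat_algebra_derivative[OF \<open>c > 0\<close> f] by blast
    then have "deriv f = f'" by (auto intro: DERIV_imp_deriv)
    with f' show ?thesis by simp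
  qed
  show *: "(deriv ^^ k) f \<in> flat_algebra c a b"
    by (induction k) (auto simp: assms D)
  show "(deriv ^^ k) f differentiable_on UNIV"
    using flat_algebra_derivative[OF assms(1) *]
    unfolding differentiable_on_def by (meson differentiable_at_withinI real_differentiable_def)
qed

text \<open>
  The exponents are \<open>1 / (n + 1)\<close> in order that \<open>bump n a b\<close> increases to the indicator of \<open>(a,b)\<close>,
  so that integrals against test functions determine integrals over intervals.
\<close>

definition bump :: "nat \<Rightarrow> real \<Rightarrow> real \<Rightarrow> real \<Rightarrow> real" where
  "bump n a b x = flat (1 / Suc n) 0 (x - a) * flat (1 / Suc n) 0 (b - x)"

lemma bump_in_flat_algebra: "bump n a b \<in> flat_algebra (1 / Suc n) a b"
  unfolding bump_def[abs_def] by (intro flat_algebra.intros)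

lemma bump_bounds: "0 \<le> bump n a b x" "bump n a b x \<le> 1"
  by (auto simp: bump_def flat_def intro!: mult_le_one)

lemma bump_eq_0: "x \<notin> {a<..<b} \<Longrightarrow> bump n a b x = 0"
  by (auto simp: bump_def flat_def)

lemma bump_tendsto_indicator: "(\<lambda>n. bump n a b x) \<longlonglongrightarrow> indicator {a<..<b} x"
proof (cases "x \<in> {a<..<b}")
  case True
  have "(\<lambda>n. exp (- (1 / Suc n) / y)) \<longlonglongrightarrow> exp (- 0 / y)" if "y > 0" for y :: real
    using that by (intro tendsto_intros LIMSEQ_Suc[OF lim_1_over_n]) auto
  from tendsto_mult[OF this[of "x - a"] this[of "b - x"]] show ?thesis
    using True by (simp add: bump_def flat_def)
next
  case False
  then show ?thesis by (simp add: bump_eq_0)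
qed

lemma continuous_on_bump: "continuous_on S (bump n a b)"
  using flat_algebra_smooth(2)[OF _ bump_in_flat_algebra[of n a b], of 0]
  by (auto intro: continuous_on_subset differentiable_imp_continuous_on)

lemma test_functions_vanish:
  assumes "\<eta> \<in> test_functions l" "s \<notin> {0<..<l}" shows "\<eta> s = 0"
  using assms unfolding test_functions_def by blast

lemma test_functions_derivative:
  assumes "\<eta> \<in> test_functions l"
  shows "((deriv ^^ k) \<eta> has_real_derivative (deriv ^^ Suc k) \<eta> s) (at s)"
proof -
  have "(deriv ^^ k) \<eta> differentiable at s"
    using assms unfolding test_functions_def differentiable_on_def by auto
  then show ?thesis
    by (metis DERIV_deriv_iff_real_differentiable funpow.simps(2) o_apply)
qed

lemma deriv_test_functions:
  assumes "\<eta> \<in> test_functions l" shows "deriv \<eta> \<in> test_functions l"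
proof -
  obtain K where K: "compact K" "K \<subseteq> {0<..<l}" "\<And>s. s \<notin> K \<Longrightarrow> \<eta> s = 0"
    using assms unfolding test_functions_def by blast
  have "deriv \<eta> s = 0" if "s \<notin> K" for s
  proof -
    have "((\<lambda>_. 0) has_real_derivative 0) (at s)" by simp
    then have "(\<eta> has_real_derivative 0) (at s)"
      by (rule has_field_derivative_transform_within_open[of _ _ _ "- K"])
         (use K that in \<open>auto simp: open_Compl compact_imp_closed\<close>)
    then show ?thesis by (rule DERIV_imp_deriv)
  qed
  moreover have "(deriv ^^ k) (deriv \<eta>) differentiable_on UNIV" for k
    using assms unfolding test_functions_def funpow_swap1[symmetric]
    by (metis (no_types, lifting) funpow.simps(2) mem_Collect_eq o_apply)
  ultimately show ?thesis
    using K unfolding test_functions_def by blast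
qed

lemma deriv_funpow_test_functions:
  "\<eta> \<in> test_functions l \<Longrightarrow> (deriv ^^ k) \<eta> \<in> test_functions l"
  by (induction k) (auto intro: deriv_test_functions)

lemma test_functions_continuous:
  "\<eta> \<in> test_functions l \<Longrightarrow> continuous_on S \<eta>"
  using test_functions_derivative[of \<eta> l 0]
  by (auto intro!: continuous_at_imp_continuous_on DERIV_isCont)

lemma bump_test_functions:
  assumes "0 < a" "b < l" shows "bump n a b \<in> test_functions l"
proof -
  have "compact {a..b}" "{a..b} \<subseteq> {0<..<l}" "\<forall>s. s \<notin> {a..b} \<longrightarrow> bump n a b s = 0"
    using assms by (auto intro!: bump_eq_0)
  then show ?thesis
    using flat_algebra_smooth(2)[OF _ bump_in_flat_algebra[of n a b]]
    unfolding test_functions_def by (auto intro!: exI[of _ "{a..b}"])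
qed

lemma test_functions_lincomb:
  assumes f: "f \<in> test_functions l" and g: "g \<in> test_functions l"
  shows "(\<lambda>x. p * f x + q * g x) \<in> test_functions l"
proof -
  have *: "(deriv ^^ k) (\<lambda>x. p * f x + q * g x) = (\<lambda>x. p * (deriv ^^ k) f x + q * (deriv ^^ k) g x)" for k
  proof (induction k)
    case (Suc k)
    have "((\<lambda>x. p * (deriv ^^ k) f x + q * (deriv ^^ k) g x) has_real_derivative
          p * (deriv ^^ Suc k) f x + q * (deriv ^^ Suc k) g x) (at x)" for x
      by (intro DERIV_add DERIV_cmult test_functions_derivative[OF f] test_functions_derivative[OF g])
    then show ?case
      by (auto simp: Suc intro!: DERIV_imp_deriv)
  qed simp
  obtain K K' where "compact K" "K \<subseteq> {0<..<l}" "\<And>s. s \<notin> K \<Longrightarrow> f s = 0"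
     "compact K'" "K' \<subseteq> {0<..<l}" "\<And>s. s \<notin> K' \<Longrightarrow> g s = 0"
    using f g unfolding test_functions_def by blast
  then have "\<exists>K. compact K \<and> K \<subseteq> {0<..<l} \<and> (\<forall>s. s \<notin> K \<longrightarrow> p * f s + q * g s = 0)"
    by (intro exI[of _ "K \<union> K'"]) auto
  moreover have "(deriv ^^ k) (\<lambda>x. p * f x + q * g x) differentiable_on UNIV" for k
    using f g unfolding * test_functions_def by (auto intro!: derivative_intros)
  ultimately show ?thesis
    unfolding test_functions_def by blast
qed

section \<open>The fundamental lemma of the calculus of variations\<close>

lemma finite_measure_interval: "finite_measure (lebesgue_on {0<..<l::real})"
  by (intro finite_measure_lebesgue_on bounded_set_imp_lmeasurable) auto

lemma L2_imp_integrable: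
  assumes "f \<in> L2 l" shows "integrable (lebesgue_on {0<..<l}) f"
proof -
  interpret finite_measure "lebesgue_on {0<..<l}" by (rule finite_measure_interval)
  show ?thesis
  proof (rule Bochner_Integration.integrable_bound)
    show "integrable (lebesgue_on {0<..<l}) (\<lambda>s. 1 + (norm (f s))\<^sup>2)"
      using assms by (auto simp: L2_def)
    have "norm (f s) \<le> 1 + (norm (f s))\<^sup>2" for s
    proof -
      have "2 * norm (f s) \<le> 1 + (norm (f s))\<^sup>2"
        using zero_le_power2[of "norm (f s) - 1"] by (simp add: power2_diff)
      with norm_ge_zero[of "f s"] show ?thesis by linarith
    qed
    then show "AE s in lebesgue_on {0<..<l}. norm (f s) \<le> norm (1 + (norm (f s))\<^sup>2)"
      by (intro AE_I2) (metis abs_ge_self order_trans real_norm_def)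
  qed (use assms in \<open>auto simp: L2_def\<close>)
qed

lemma integrable_continuous_interval:
  fixes f :: "real \<Rightarrow> 'a::euclidean_space"
  assumes "continuous_on {0..l} f"
  shows "integrable (lebesgue_on {0<..<l}) f"
proof -
  interpret finite_measure "lebesgue_on {0<..<l}" by (rule finite_measure_interval)
  obtain C where "\<And>s. s \<in> {0..l} \<Longrightarrow> norm (f s) \<le> C"
    using compact_imp_bounded[OF compact_continuous_image[OF assms compact_Icc]]
    by (metis bounded_iff imageI)
  then show ?thesis
    by (intro integrable_const_bound[of _ C] AE_I2 continuous_imp_measurable_on_sets_lebesgue
        continuous_on_subset[OF assms]) auto
qed

lemma integrable_mult_continuous:
  fixes g :: "real \<Rightarrow> 'a::euclidean_space" and f :: "real \<Rightarrow> real"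
  assumes g: "integrable (lebesgue_on {0<..<l}) g" and f: "continuous_on {0..l} f"
  shows "integrable (lebesgue_on {0<..<l}) (\<lambda>s. f s *\<^sub>R g s)"
proof -
  obtain C where C: "\<And>s. s \<in> {0..l} \<Longrightarrow> norm (f s) \<le> C"
    using compact_imp_bounded[OF compact_continuous_image[OF f compact_Icc]]
    by (metis bounded_iff imageI)
  have "f \<in> borel_measurable (lebesgue_on {0<..<l})"
    by (intro continuous_imp_measurable_on_sets_lebesgue continuous_on_subset[OF f]) auto
  moreover have "g \<in> borel_measurable (lebesgue_on {0<..<l})"
    using g by auto
  ultimately have m: "(\<lambda>s. f s *\<^sub>R g s) \<in> borel_measurable (lebesgue_on {0<..<l})"
    by simp
  have "norm (f s *\<^sub>R g s) \<le> norm (C * norm (g s))" if "s \<in> {0<..<l}" for s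
  proof -
    have "\<bar>f s\<bar> \<le> \<bar>C\<bar>" using C[of s] that by auto
    then show ?thesis by (simp add: abs_mult mult_right_mono)
  qed
  then have "AE s in lebesgue_on {0<..<l}. norm (f s *\<^sub>R g s) \<le> norm (C * norm (g s))"
    by (intro AE_I2) simp
  from Bochner_Integration.integrable_bound[OF _ m this] g show ?thesis
    by simp
qed

lemma integral_indicator_interval:
  fixes f :: "real \<Rightarrow> 'a::euclidean_space"
  assumes f: "integrable (lebesgue_on {0<..<l}) f" and "0 \<le> a" "b \<le> l"
  shows "integrable (lebesgue_on {0<..<l}) (\<lambda>s. indicator {a<..<b} s *\<^sub>R f s)"
    and "(LINT s|lebesgue_on {0<..<l}. indicator {a<..<b} s *\<^sub>R f s) = integral {a..b} f"
proof -
  have "{a<..<b} \<in> sets (lebesgue_on {0<..<l})"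
    using assms(2,3) by (auto simp: sets_restrict_space intro!: image_eqI[of _ _ "{a<..<b}"])
  then show *: "integrable (lebesgue_on {0<..<l}) (\<lambda>s. indicator {a<..<b} s *\<^sub>R f s)"
    using f by (rule integrable_mult_indicator)
  have "(LINT s|lebesgue_on {0<..<l}. indicator {a<..<b} s *\<^sub>R f s)
      = integral {0<..<l} (\<lambda>s. indicator {a<..<b} s *\<^sub>R f s)"
    by (rule lebesgue_integral_eq_integral[OF *]) simp
  also have "\<dots> = integral {0<..<l} (\<lambda>s. if s \<in> {a<..<b} then f s else 0)"
    by (rule arg_cong[where f = "integral _"]) (auto simp: indicator_def)
  also have "\<dots> = integral ({a<..<b} \<inter> {0<..<l}) f"
    by (rule integral_restrict_Int)
  also have "{a<..<b} \<inter> {0<..<l} = {a<..<b}"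
    using assms by auto
  finally show "(LINT s|lebesgue_on {0<..<l}. indicator {a<..<b} s *\<^sub>R f s) = integral {a..b} f"
    by (simp add: integral_open_interval_real)
qed

lemma integral_interval_eq:
  fixes f :: "real \<Rightarrow> 'a::euclidean_space"
  assumes "integrable (lebesgue_on {0<..<l}) f"
  shows "(LINT s|lebesgue_on {0<..<l}. f s) = integral {0..l} f"
  using lebesgue_integral_eq_integral[OF assms] by (simp add: integral_open_interval_real)

text \<open>
  Dominated convergence: identities that hold against all test functions pass to integrals over
  intervals.
\<close>

lemma bump_integral_tendsto:
  fixes g :: "real \<Rightarrow> 'a::euclidean_space"
  assumes g: "integrable (lebesgue_on {0<..<l}) g" and "0 < a" "b < l"
  shows "(\<lambda>n. LINT s|lebesgue_on {0<..<l}. bump n a b s *\<^sub>R g s) \<longlonglongrightarrow> integral {a..b} g"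
proof -
  have "(\<lambda>n. LINT s|lebesgue_on {0<..<l}. bump n a b s *\<^sub>R g s)
     \<longlonglongrightarrow> (LINT s|lebesgue_on {0<..<l}. indicator {a<..<b} s *\<^sub>R g s)"
  proof (rule integral_dominated_convergence[where w = "\<lambda>s. norm (g s)"])
    show "(\<lambda>s. indicator {a<..<b} s *\<^sub>R g s) \<in> borel_measurable (lebesgue_on {0<..<l})"
      using integral_indicator_interval(1)[OF g, of a b] assms by auto
    show "(\<lambda>s. bump n a b s *\<^sub>R g s) \<in> borel_measurable (lebesgue_on {0<..<l})" for n
      using integrable_mult_continuous[OF g continuous_on_bump] by auto
    show "AE s in lebesgue_on {0<..<l}. (\<lambda>n. bump n a b s *\<^sub>R g s) \<longlonglongrightarrow> indicator {a<..<b} s *\<^sub>R g s"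
      by (intro AE_I2 tendsto_intros bump_tendsto_indicator)
    show "AE s in lebesgue_on {0<..<l}. norm (bump n a b s *\<^sub>R g s) \<le> norm (g s)" for n
      by (intro AE_I2) (simp add: bump_bounds mult_left_le_one_le)
  qed (use g in auto)
  also have "(LINT s|lebesgue_on {0<..<l}. indicator {a<..<b} s *\<^sub>R g s) = integral {a..b} g"
    using integral_indicator_interval(2)[OF g, of a b] assms by simp
  finally show ?thesis .
qed

text \<open>
  Almost every point is a Lebesgue point of \<open>g\<close>, and there \<open>g\<close> is the limit of its vanishing mean
  values.
\<close>

lemma AE_eq_0_if_interval_integrals:
  fixes g :: "real \<Rightarrow> 'a::euclidean_space"
  assumes g: "integrable (lebesgue_on {0<..<l}) g"
    and zero: "\<And>a b. 0 < a \<Longrightarrow> a < b \<Longrightarrow> b < l \<Longrightarrow> integral {a..b} g = 0"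
  shows "AE s in lebesgue_on {0<..<l}. g s = 0"
proof -
  define f where "f = (\<lambda>s. if s \<in> {0<..<l} then g s else 0)"
  have "integrable lebesgue f"
    unfolding f_def using Lebesgue_Measure.integrable_restrict_UNIV[of "{0<..<l}" g] g
    by (simp only: sets_completionI_sets sets_lborel borel_open open_greaterThanLessThan)
  then have "f integrable_on UNIV" by (rule integrable_on_lebesgue)
  then have "f integrable_on cbox a b" for a b
    by (rule integrable_on_subcbox) simp
  from integrable_ccontinuous_explicit[OF this] obtain N where N: "negligible N"
    "\<And>x e. \<lbrakk>x \<notin> N; 0 < e\<rbrakk> \<Longrightarrow> \<exists>d>0. \<forall>h. 0 < h \<and> h < d \<longrightarrow>
       norm (integral (cbox x (x + h *\<^sub>R One)) f /\<^sub>R h ^ DIM(real) - f x) < e"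
    by blast
  have "g x = 0" if x: "x \<in> {0<..<l}" "x \<notin> N" for x
  proof (rule ccontr)
    assume "g x \<noteq> 0"
    then obtain d where d: "d > 0" "\<And>h. 0 < h \<Longrightarrow> h < d \<Longrightarrow>
       norm (integral (cbox x (x + h *\<^sub>R One)) f /\<^sub>R h ^ DIM(real) - f x) < norm (g x)"
      using N(2)[OF x(2), of "norm (g x)"] by auto
    define h where "h = min d (l - x) / 2"
    have h: "0 < h" "h < d" "x + h < l"
      using d x by (auto simp: h_def min_def field_simps)
    have "integral {x..x + h} f = integral {x..x + h} g"
      using x h by (intro integral_cong) (auto simp: f_def)
    also have "\<dots> = 0"
      using x h by (intro zero) auto
    finally show False
      using d(2)[OF h(1,2)] x by (simp add: f_def)
  qed
  then have "AE x in lebesgue. x \<in> {0<..<l} \<longrightarrow> g x = 0"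
    using N(1) by (intro AE_I'[of N]) (auto simp: negligible_iff_null_sets)
  then show ?thesis
    by (subst AE_restrict_space_iff) auto
qed

lemma fundamental_lemma:
  fixes g :: "real \<Rightarrow> 'a::euclidean_space"
  assumes g: "integrable (lebesgue_on {0<..<l}) g"
    and zero: "\<And>\<eta>. \<eta> \<in> test_functions l \<Longrightarrow> (LINT s|lebesgue_on {0<..<l}. \<eta> s *\<^sub>R g s) = 0"
  shows "AE s in lebesgue_on {0<..<l}. g s = 0"
proof (rule AE_eq_0_if_interval_integrals[OF g])
  fix a b :: real assume "0 < a" "b < l"
  then show "integral {a..b} g = 0"
    using bump_integral_tendsto[OF g, of a b]
    by (simp add: zero bump_test_functions LIMSEQ_const_iff)
qed

text \<open>
  The indefinite integral is constant on either side of the support; the vanishing mean makes the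
  constant on the right equal to the one on the left, which is \<open>0\<close>.
\<close>

lemma test_function_antiderivative:
  assumes \<psi>: "\<psi> \<in> test_functions l" and mean: "integral {0..l} \<psi> = 0"
  shows "\<exists>\<eta>\<in>test_functions l. deriv \<eta> = \<psi>"
proof -
  obtain K where K: "compact K" "K \<subseteq> {0<..<l}" "\<And>s. s \<notin> K \<Longrightarrow> \<psi> s = 0"
    using \<psi> unfolding test_functions_def by blast
  show ?thesis
  proof (cases "K = {}")
    case True
    then have "\<psi> = (\<lambda>_. 0)" using K by auto
    then show ?thesis using \<psi> by (intro bexI[of _ \<psi>]) auto
  next
    case False
    obtain a where a: "a \<in> K" "\<And>s. s \<in> K \<Longrightarrow> a \<le> s"
      using compact_attains_inf[OF K(1) False] by blast
    obtain b where b: "b \<in> K" "\<And>s. s \<in> K \<Longrightarrow> s \<le> b"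
      using compact_attains_sup[OF K(1) False] by blast
    have ab: "0 < a" "a \<le> b" "b < l"
      using a b K(2) by auto
    have supp: "\<psi> s = 0" if "s \<notin> {a..b}" for s
      using K(3)[of s] a(2)[of s] b(2)[of s] that by auto
    have cont: "continuous_on S \<psi>" for S
      by (rule test_functions_continuous[OF \<psi>])
    define \<eta> where "\<eta> x = integral {0..x} \<psi>" for x
    have left: "\<eta> x = 0" if "x < a" for x
      unfolding \<eta>_def using that by (intro integral_unique has_integral_is_0) (auto intro: supp)
    have right: "\<eta> x = \<eta> l" if "b < x" for x
    proof -
      have "\<eta> y = integral {0..b} \<psi>" if "b < y" for y
      proof -
        have "integral {0..b} \<psi> + integral {b..y} \<psi> = \<eta> y"
          unfolding \<eta>_def using ab that
          by (intro Henstock_Kurzweil_Integration.integral_combine integrable_continuous_real cont) auto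
        moreover have "integral {b..y} \<psi> = 0"
        proof -
          have "integral {b<..<y} \<psi> = 0"
            by (intro integral_unique has_integral_is_0) (auto intro: supp)
          then show ?thesis by (simp add: integral_open_interval_real)
        qed
        ultimately show ?thesis by simp
      qed
      then show ?thesis using that ab by simp
    qed
    have der: "(\<eta> has_real_derivative \<psi> x) (at x)" for x
    proof (cases "x < a")
      case True
      have "((\<lambda>_. 0) has_real_derivative \<psi> x) (at x)"
        using supp[of x] True by simp
      then show ?thesis
        by (rule has_field_derivative_transform_within_open[of _ _ _ "{..<a}"])
           (use True left in auto)
    next
      case False
      then have x: "0 < x" using ab by simp
      have "(\<eta> has_real_derivative \<psi> x) (at x within {0..x + 1})"
        unfolding \<eta>_def[abs_def] by (rule integral_has_real_derivative[OF cont]) (use x in auto)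
      then show ?thesis
        using x at_within_Icc_at[of 0 x "x + 1"] by simp
    qed
    have d: "deriv \<eta> = \<psi>"
      using der by (auto intro!: DERIV_imp_deriv)
    have "(deriv ^^ k) \<eta> differentiable_on UNIV" for k
    proof (cases k)
      case 0
      then show ?thesis
        using der unfolding differentiable_on_def
        by (auto intro: differentiable_at_withinI simp: real_differentiable_def)
    next
      case (Suc j)
      then have "(deriv ^^ k) \<eta> = (deriv ^^ j) \<psi>"
        by (simp add: funpow_swap1 d)
      then show ?thesis
        using \<psi> by (simp add: test_functions_def)
    qed
    moreover have "\<eta> s = 0" if "s \<notin> {a..b}" for s
      using left[of s] right[of s] that mean by (auto simp: \<eta>_def not_le)
    ultimately have "\<eta> \<in> test_functions l"
      unfolding test_functions_def using ab by (auto intro!: exI[of _ "{a..b}"])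
    with d show ?thesis by blast
  qed
qed

text \<open>
  A combination of two bumps with vanishing integral is a derivative of a test function. In the limit
  this says that \<open>h\<close> has the same mean value over any two intervals, so subtracting the mean over one
  fixed interval (the middle third) leaves a function whose integrals over intervals all vanish.
\<close>

lemma du_bois_reymond:
  fixes h :: "real \<Rightarrow> 'a::euclidean_space"
  assumes "l > 0" and h: "integrable (lebesgue_on {0<..<l}) h"
    and zero: "\<And>\<eta>. \<eta> \<in> test_functions l \<Longrightarrow> (LINT s|lebesgue_on {0<..<l}. deriv \<eta> s *\<^sub>R h s) = 0"
  shows "\<exists>m. AE s in lebesgue_on {0<..<l}. h s = m"
proof -
  interpret finite_measure "lebesgue_on {0<..<l}" by (rule finite_measure_interval)
  have one: "integrable (lebesgue_on {0<..<l}) (\<lambda>_. 1 :: real)" by simp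
  have len: "integral {a..b} (\<lambda>_. 1 :: real) = b - a" if "a < b" for a b :: real
    using that by simp
  have avg: "(d - c) *\<^sub>R integral {a..b} h = (b - a) *\<^sub>R integral {c..d} h"
    if "0 < a" "a < b" "b < l" "0 < c" "c < d" "d < l" for a b c d
  proof -
    define I where "I n a b = (LINT s|lebesgue_on {0<..<l}. bump n a b s *\<^sub>R (1 :: real))" for n a b
    define J where "J n a b = (LINT s|lebesgue_on {0<..<l}. bump n a b s *\<^sub>R h s)" for n a b
    have eq: "I n c d *\<^sub>R J n a b = I n a b *\<^sub>R J n c d" for n
    proof -
      \<comment> \<open>The coefficients are chosen to make the integral of \<open>\<psi>\<close> vanish.\<close>
      define \<psi> where "\<psi> = (\<lambda>s. I n c d * bump n a b s + (- I n a b) * bump n c d s)"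
      have \<psi>: "\<psi> \<in> test_functions l"
        unfolding \<psi>_def using that by (intro test_functions_lincomb bump_test_functions) auto
      have ib: "integrable (lebesgue_on {0<..<l}) (\<lambda>s. bump n a b s *\<^sub>R f s)"
        if "integrable (lebesgue_on {0<..<l}) f" for a b and f :: "real \<Rightarrow> 'b::euclidean_space"
        by (rule integrable_mult_continuous[OF that continuous_on_bump])
      have lin: "(LINT s|lebesgue_on {0<..<l}. \<psi> s *\<^sub>R f s) =
          I n c d *\<^sub>R (LINT s|lebesgue_on {0<..<l}. bump n a b s *\<^sub>R f s) -
          I n a b *\<^sub>R (LINT s|lebesgue_on {0<..<l}. bump n c d s *\<^sub>R f s)"
        if "integrable (lebesgue_on {0<..<l}) f" for f :: "real \<Rightarrow> 'b::euclidean_space"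
      proof -
        have "(LINT s|lebesgue_on {0<..<l}. \<psi> s *\<^sub>R f s) = (LINT s|lebesgue_on {0<..<l}.
           I n c d *\<^sub>R (bump n a b s *\<^sub>R f s) - I n a b *\<^sub>R (bump n c d s *\<^sub>R f s))"
          by (simp add: \<psi>_def scaleR_left_diff_distrib)
        also have "\<dots> = (LINT s|lebesgue_on {0<..<l}. I n c d *\<^sub>R (bump n a b s *\<^sub>R f s)) -
            (LINT s|lebesgue_on {0<..<l}. I n a b *\<^sub>R (bump n c d s *\<^sub>R f s))"
          by (rule Bochner_Integration.integral_diff) (intro integrable_scaleR_right ib that)+
        finally show ?thesis
          by (simp only: integral_scaleR_right)
      qed
      have "integral {0..l} \<psi> = (LINT s|lebesgue_on {0<..<l}. \<psi> s *\<^sub>R 1)"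
        using integral_interval_eq[OF integrable_continuous_interval[OF test_functions_continuous[OF \<psi>]]]
        by simp
      also have "\<dots> = 0"
        by (subst lin[OF one]) (simp add: I_def)
      finally obtain \<eta> where "\<eta> \<in> test_functions l" "deriv \<eta> = \<psi>"
        using test_function_antiderivative[OF \<psi>] by blast
      then have "(LINT s|lebesgue_on {0<..<l}. \<psi> s *\<^sub>R h s) = 0"
        using zero by metis
      then show ?thesis
        by (simp add: lin[OF h] J_def)
    qed
    have "(\<lambda>n. I n c d *\<^sub>R J n a b) \<longlonglongrightarrow> (d - c) *\<^sub>R integral {a..b} h"
      using bump_integral_tendsto[OF one, of c d] bump_integral_tendsto[OF h, of a b] that
      unfolding I_def J_def by (intro tendsto_intros) (auto simp: len)
    moreover have "(\<lambda>n. I n a b *\<^sub>R J n c d) \<longlonglongrightarrow> (b - a) *\<^sub>R integral {c..d} h"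
      using bump_integral_tendsto[OF one, of a b] bump_integral_tendsto[OF h, of c d] that
      unfolding I_def J_def by (intro tendsto_intros) (auto simp: len)
    ultimately show ?thesis
      unfolding eq by (rule LIMSEQ_unique)
  qed
  define m where "m = integral {l / 3..2 * l / 3} h /\<^sub>R (l / 3)"
  have "AE s in lebesgue_on {0<..<l}. h s - m = 0"
  proof (rule AE_eq_0_if_interval_integrals)
    show "integrable (lebesgue_on {0<..<l}) (\<lambda>s. h s - m)"
      using h by simp
    fix a b :: real assume ab: "0 < a" "a < b" "b < l"
    have "h integrable_on {0..l}"
      using integrable_on_lebesgue_on[OF h] by (simp add: integrable_on_Icc_iff_Ioo)
    then have hi: "h integrable_on {a..b}"
      using ab by (auto intro: integrable_on_subinterval)
    have "integral {a..b} (\<lambda>s. h s - m) = integral {a..b} h - (b - a) *\<^sub>R m"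
      using hi ab by (subst Henstock_Kurzweil_Integration.integral_diff) auto
    also have "(b - a) *\<^sub>R m = integral {a..b} h"
    proof -
      have "(b - a) *\<^sub>R m = inverse (l / 3) *\<^sub>R ((b - a) *\<^sub>R integral {l / 3..2 * l / 3} h)"
        by (simp add: m_def)
      also have "\<dots> = inverse (l / 3) *\<^sub>R ((l / 3) *\<^sub>R integral {a..b} h)"
        using avg[of a b "l / 3" "2 * l / 3"] ab \<open>l > 0\<close> by simp
      also have "\<dots> = integral {a..b} h"
        using \<open>l > 0\<close> by simp
      finally show ?thesis .
    qed
    finally show "integral {a..b} (\<lambda>s. h s - m) = 0" by simp
  qed
  then show ?thesis by auto
qed

section \<open>Weak derivatives and continuous representatives\<close>

text \<open>
  By Fubini: the double integral of \<open>\<eta>' s *\<^sub>R g y\<close> over the triangle \<open>y < s\<close>, integrated first in \<open>y\<close>, is the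
  left-hand side; integrated first in \<open>s\<close> it is the right-hand side, since \<open>\<eta>\<close> vanishes at \<open>l\<close>.
\<close>

lemma weak_derivative_indefinite_integral:
  fixes g :: "real \<Rightarrow> 'a::euclidean_space"
  assumes g: "integrable (lebesgue_on {0<..<l}) g" and \<eta>: "\<eta> \<in> test_functions l"
  shows "(LINT s|lebesgue_on {0<..<l}. deriv \<eta> s *\<^sub>R integral {0..s} g) =
         - (LINT s|lebesgue_on {0<..<l}. \<eta> s *\<^sub>R g s)"
proof -
  let ?M = "lebesgue_on {0<..<l}"
  interpret finite_measure ?M by (rule finite_measure_interval)
  interpret P: pair_sigma_finite ?M ?M ..
  have \<eta>': "deriv \<eta> \<in> test_functions l"
    by (rule deriv_test_functions[OF \<eta>])
  have \<eta>'_int: "integrable ?M (deriv \<eta>)"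
    by (rule integrable_continuous_interval[OF test_functions_continuous[OF \<eta>']])
  define F where "F s y = (indicator {0<..<s} y * deriv \<eta> s) *\<^sub>R g y" for s y
  have inner1: "(LINT y|?M. F s y) = deriv \<eta> s *\<^sub>R integral {0..s} g" if "s \<in> {0<..<l}" for s
  proof -
    have "(LINT y|?M. F s y) = (LINT y|?M. deriv \<eta> s *\<^sub>R (indicator {0<..<s} y *\<^sub>R g y))"
      by (simp add: F_def mult.commute)
    also have "\<dots> = deriv \<eta> s *\<^sub>R (LINT y|?M. indicator {0<..<s} y *\<^sub>R g y)"
      by (rule integral_scaleR_right)
    also have "(LINT y|?M. indicator {0<..<s} y *\<^sub>R g y) = integral {0..s} g"
      using integral_indicator_interval(2)[OF g, of 0 s] that by auto
    finally show ?thesis .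
  qed
  have inner2: "(LINT s|?M. F s y) = - \<eta> y *\<^sub>R g y" if y: "y \<in> {0<..<l}" for y
  proof -
    have "(LINT s|?M. F s y) = (LINT s|?M. (indicator {y<..<l} s *\<^sub>R deriv \<eta> s) *\<^sub>R g y)"
      using y by (intro Bochner_Integration.integral_cong) (auto simp: F_def indicator_def)
    also have "\<dots> = (LINT s|?M. indicator {y<..<l} s *\<^sub>R deriv \<eta> s) *\<^sub>R g y"
      using integral_indicator_interval(1)[OF \<eta>'_int, of y l] y by (intro integral_scaleR_left) auto
    also have "(LINT s|?M. indicator {y<..<l} s *\<^sub>R deriv \<eta> s) = integral {y..l} (deriv \<eta>)"
      using integral_indicator_interval(2)[OF \<eta>'_int, of y l] y by auto
    also have "\<dots> = \<eta> l - \<eta> y"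
      using y test_functions_derivative[OF \<eta>, of 0]
      by (intro integral_unique fundamental_theorem_of_calculus)
         (auto simp: has_real_derivative_iff_has_vector_derivative[symmetric] intro: has_field_derivative_at_within)
    also have "\<eta> l = 0"
      by (rule test_functions_vanish[OF \<eta>]) simp
    finally show ?thesis by simp
  qed
  have "integrable (?M \<Otimes>\<^sub>M ?M) (\<lambda>(s, y). F s y)"
  proof (rule P.Fubini_integrable)
    have [measurable]: "(\<lambda>x. x) \<in> borel_measurable ?M" "deriv \<eta> \<in> borel_measurable ?M" "g \<in> borel_measurable ?M"
      using id_borel_measurable_lebesgue_on[of "{0<..<l}"] \<eta>'_int g by (auto simp: id_def)
    have [measurable]: "fst \<in> borel_measurable (?M \<Otimes>\<^sub>M ?M)" "snd \<in> borel_measurable (?M \<Otimes>\<^sub>M ?M)"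
      by (auto intro: measurable_compose[OF measurable_fst] measurable_compose[OF measurable_snd])
    have eq: "(\<lambda>(s, y). F s y) = (\<lambda>p. ((if 0 < snd p \<and> snd p < fst p then 1 else 0) * deriv \<eta> (fst p)) *\<^sub>R g (snd p))"
      by (auto simp: F_def fun_eq_iff)
    show meas: "(\<lambda>(s, y). F s y) \<in> borel_measurable (?M \<Otimes>\<^sub>M ?M)"
      unfolding eq by measurable
    show "AE s in ?M. integrable ?M (\<lambda>y. case (s, y) of (s, y) \<Rightarrow> F s y)"
    proof (rule AE_I2)
      fix s assume "s \<in> space ?M"
      then have "integrable ?M (\<lambda>y. deriv \<eta> s *\<^sub>R (indicator {0<..<s} y *\<^sub>R g y))"
        using integral_indicator_interval(1)[OF g, of 0 s] by (intro integrable_scaleR_right) auto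
      then show "integrable ?M (\<lambda>y. case (s, y) of (s, y) \<Rightarrow> F s y)"
        by (simp add: F_def mult.commute)
    qed
    obtain C where C: "\<And>s. s \<in> {0..l} \<Longrightarrow> norm (deriv \<eta> s) \<le> C"
      using compact_imp_bounded[OF compact_continuous_image[OF test_functions_continuous[OF \<eta>'] compact_Icc]]
      by (metis bounded_iff imageI)
    have bound: "norm (LINT y|?M. norm (F s y)) \<le> (LINT y|?M. C * norm (g y))" if s: "s \<in> {0<..<l}" for s
    proof -
      have F: "norm (F s y) \<le> C * norm (g y)" for y
      proof -
        have "norm (F s y) \<le> \<bar>deriv \<eta> s\<bar> * norm (g y)"
          by (auto simp: F_def indicator_def)
        also have "\<dots> \<le> C * norm (g y)"
          using C[of s] s by (intro mult_right_mono) auto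
        finally show ?thesis .
      qed
      have "(LINT y|?M. norm (F s y)) \<le> (LINT y|?M. C * norm (g y))"
        using g F order_trans[OF norm_ge_zero F]
        by (intro integral_mono_AE' AE_I2) auto
      then show ?thesis by simp
    qed
    have "(\<lambda>s. LINT y|?M. norm (F s y)) \<in> borel_measurable ?M"
      using meas by (intro borel_measurable_lebesgue_integral) (simp add: split_def)
    then show "integrable ?M (\<lambda>s. LINT y|?M. norm (case (s, y) of (s, y) \<Rightarrow> F s y))"
      using bound by (intro integrable_const_bound[where B = "LINT y|?M. C * norm (g y)"] AE_I2) auto
  qed
  then have "(LINT y|?M. LINT s|?M. F s y) = (LINT s|?M. LINT y|?M. F s y)"
    by (rule P.Fubini_integral)
  moreover have "(LINT s|?M. LINT y|?M. F s y) = (LINT s|?M. deriv \<eta> s *\<^sub>R integral {0..s} g)"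
    by (intro Bochner_Integration.integral_cong) (auto simp: inner1)
  moreover have "(LINT y|?M. LINT s|?M. F s y) = (LINT y|?M. - (\<eta> y *\<^sub>R g y))"
    by (intro Bochner_Integration.integral_cong) (auto simp: inner2)
  ultimately show ?thesis by simp
qed

text \<open>
  The weak derivatives of all orders are defined from \<open>f\<close> itself. Testing with the derivative of a test
  function shows that each of them is a first weak derivative of the preceding one.
\<close>

lemma has_weak_deriv_step:
  assumes f: "has_weak_deriv l k f g" and h: "has_weak_deriv l (Suc k) f h"
  shows "has_weak_deriv l 1 g h"
  unfolding has_weak_deriv_def
proof
  fix \<eta> assume \<eta>: "\<eta> \<in> test_functions l"
  let ?I = "\<lambda>f. LINT s|lebesgue_on {0<..<l}. f s"
  have "(- 1) ^ k *\<^sub>R ?I (\<lambda>s. deriv \<eta> s *\<^sub>R g s) = ?I (\<lambda>s. (deriv ^^ k) (deriv \<eta>) s *\<^sub>R f s)"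
    using f deriv_test_functions[OF \<eta>] by (simp add: has_weak_deriv_def)
  also have "\<dots> = (- 1) ^ Suc k *\<^sub>R ?I (\<lambda>s. \<eta> s *\<^sub>R h s)"
    using h \<eta> by (simp add: has_weak_deriv_def funpow_swap1)
  finally have "(- 1) ^ k *\<^sub>R (?I (\<lambda>s. deriv \<eta> s *\<^sub>R g s) + ?I (\<lambda>s. \<eta> s *\<^sub>R h s)) = 0"
    by (simp add: scaleR_right_distrib)
  then show "?I (\<lambda>s. (deriv ^^ 1) \<eta> s *\<^sub>R g s) = (- 1) ^ 1 *\<^sub>R ?I (\<lambda>s. \<eta> s *\<^sub>R h s)"
    by (simp add: add_eq_0_iff)
qed

lemma has_weak_deriv_0: "has_weak_deriv l 0 f f"
  by (simp add: has_weak_deriv_def)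

lemma integrable_test_scaleR:
  assumes "\<eta> \<in> test_functions l" "f \<in> L2 l"
  shows "integrable (lebesgue_on {0<..<l}) (\<lambda>s. \<eta> s *\<^sub>R f s)"
  by (intro integrable_mult_continuous L2_imp_integrable test_functions_continuous[OF assms(1)] assms(2))

lemma has_weak_deriv_unique:
  assumes "g \<in> L2 l" "g' \<in> L2 l" "has_weak_deriv l k f g" "has_weak_deriv l k f g'"
  shows "AE s in lebesgue_on {0<..<l}. g s = g' s"
proof -
  have "AE s in lebesgue_on {0<..<l}. g s - g' s = 0"
  proof (rule fundamental_lemma)
    show "integrable (lebesgue_on {0<..<l}) (\<lambda>s. g s - g' s)"
      using assms(1,2)[THEN L2_imp_integrable] by simp
    fix \<eta> assume \<eta>: "\<eta> \<in> test_functions l"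
    have "(- 1) ^ k *\<^sub>R (LINT s|lebesgue_on {0<..<l}. \<eta> s *\<^sub>R g s) =
          (- 1) ^ k *\<^sub>R (LINT s|lebesgue_on {0<..<l}. \<eta> s *\<^sub>R g' s)"
      using bspec[OF assms(3)[unfolded has_weak_deriv_def] \<eta>]
        bspec[OF assms(4)[unfolded has_weak_deriv_def] \<eta>] by (rule trans[OF sym])
    then have "(LINT s|lebesgue_on {0<..<l}. \<eta> s *\<^sub>R g s) = (LINT s|lebesgue_on {0<..<l}. \<eta> s *\<^sub>R g' s)"
      by simp
    then show "(LINT s|lebesgue_on {0<..<l}. \<eta> s *\<^sub>R (g s - g' s)) = 0"
      unfolding scaleR_right_diff_distrib
      by (simp add: Bochner_Integration.integral_diff[OF integrable_test_scaleR[OF \<eta> assms(1)]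
            integrable_test_scaleR[OF \<eta> assms(2)]])
  qed
  then show ?thesis by simp
qed

lemma wderiv_unique:
  assumes "g \<in> L2 l" "has_weak_deriv l k f g"
  shows "AE s in lebesgue_on {0<..<l}. wderiv l k f s = g s"
proof -
  have "wderiv l k f \<in> L2 l \<and> has_weak_deriv l k f (wderiv l k f)"
    unfolding wderiv_def by (rule someI[of _ g]) (use assms in blast)
  then show ?thesis
    using has_weak_deriv_unique[of "wderiv l k f" l g k f] assms by simp
qed

lemma Hs_wderiv:
  assumes "f \<in> Hs l m" "k \<le> m"
  shows "wderiv l k f \<in> L2 l" "has_weak_deriv l k f (wderiv l k f)"
proof -
  have "\<exists>g. g \<in> L2 l \<and> has_weak_deriv l k f g"
    using assms by (auto simp: Hs_def)
  from someI_ex[OF this] show "wderiv l k f \<in> L2 l" "has_weak_deriv l k f (wderiv l k f)"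
    unfolding wderiv_def by blast+
qed

lemma Hs_mono: "f \<in> Hs l m \<Longrightarrow> k \<le> m \<Longrightarrow> f \<in> Hs l k"
  by (auto simp: Hs_def)

lemma indefinite_integral_continuous:
  fixes h :: "real \<Rightarrow> 'a::euclidean_space"
  assumes "integrable (lebesgue_on {0<..<l}) h"
  shows "h integrable_on {0..l}" "continuous_on {0..l} (\<lambda>s. integral {0..s} h)"
proof -
  show "h integrable_on {0..l}"
    using integrable_on_lebesgue_on[OF assms] by (simp add: integrable_on_Icc_iff_Ioo)
  then show "continuous_on {0..l} (\<lambda>s. integral {0..s} h)"
    by (rule indefinite_integral_continuous_1)
qed

text \<open>
  The difference of \<open>g\<close> and the indefinite integral of \<open>h\<close> has weak derivative \<open>0\<close>, hence is constant.
\<close>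

lemma weak_deriv_imp_indefinite_integral:
  fixes g h :: "real \<Rightarrow> 'a::euclidean_space"
  assumes l: "l > 0" and g: "g \<in> L2 l" and h: "h \<in> L2 l" and gh: "has_weak_deriv l 1 g h"
  shows "\<exists>c. AE s in lebesgue_on {0<..<l}. g s = c + integral {0..s} h"
proof -
  note hI = L2_imp_integrable[OF h]
  note cont = indefinite_integral_continuous(2)[OF hI]
  have "\<exists>c. AE s in lebesgue_on {0<..<l}. g s - integral {0..s} h = c"
  proof (rule du_bois_reymond[OF l])
    show "integrable (lebesgue_on {0<..<l}) (\<lambda>s. g s - integral {0..s} h)"
      using L2_imp_integrable[OF g] integrable_continuous_interval[OF cont] by simp
    fix \<eta> assume \<eta>: "\<eta> \<in> test_functions l"
    note \<eta>' = deriv_test_functions[OF \<eta>]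
    have "(LINT s|lebesgue_on {0<..<l}. deriv \<eta> s *\<^sub>R (g s - integral {0..s} h)) =
       (LINT s|lebesgue_on {0<..<l}. deriv \<eta> s *\<^sub>R g s) -
       (LINT s|lebesgue_on {0<..<l}. deriv \<eta> s *\<^sub>R integral {0..s} h)"
      unfolding scaleR_right_diff_distrib
      by (intro Bochner_Integration.integral_diff integrable_test_scaleR[OF \<eta>' g]
          integrable_mult_continuous[OF integrable_continuous_interval[OF cont]] test_functions_continuous[OF \<eta>'])
    also have "(LINT s|lebesgue_on {0<..<l}. deriv \<eta> s *\<^sub>R g s) = - (LINT s|lebesgue_on {0<..<l}. \<eta> s *\<^sub>R h s)"
      using gh \<eta> by (simp add: has_weak_deriv_def)
    finally show "(LINT s|lebesgue_on {0<..<l}. deriv \<eta> s *\<^sub>R (g s - integral {0..s} h)) = 0"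
      by (simp add: weak_derivative_indefinite_integral[OF hI \<eta>])
  qed
  then obtain c where "AE s in lebesgue_on {0<..<l}. g s - integral {0..s} h = c" ..
  then have "AE s in lebesgue_on {0<..<l}. g s = c + integral {0..s} h"
    by eventually_elim (simp add: algebra_simps)
  then show ?thesis ..
qed

text \<open>
  The closed set on which both functions agree contains almost every, hence every, point of the open
  interval, and therefore also the end points.
\<close>

lemma continuous_AE_eq_imp_eq:
  fixes f g :: "real \<Rightarrow> 'a::euclidean_space"
  assumes l: "l > 0" and f: "continuous_on {0..l} f" and g: "continuous_on {0..l} g"
    and ae: "AE s in lebesgue_on {0<..<l}. f s = g s" and a: "a \<in> {0..l}"
  shows "f a = g a"
proof -
  have ae': "AE s in lebesgue_on {0<..<l}. s \<in> {s. s \<in> {0..l} \<and> f s - g s = 0}"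
    by (rule lebesgue_on_mono[OF ae]) auto
  have clo: "closed {s. s \<in> {0..l} \<and> f s - g s = 0}"
    by (intro continuous_closed_preimage_constant continuous_on_diff f g closed_atLeastAtMost)
  have "{0<..<l} \<subseteq> {s. s \<in> {0..l} \<and> f s - g s = 0}"
  proof
    fix x assume x: "x \<in> {0<..<l}"
    show "x \<in> {s. s \<in> {0..l} \<and> f s - g s = 0}"
      using ae' by (intro mem_closed_if_AE_lebesgue_open[OF open_greaterThanLessThan clo _ x])
        (simp add: AE_restrict_space_iff)
  qed
  then have "closure {0<..<l} \<subseteq> {s. s \<in> {0..l} \<and> f s - g s = 0}"
    using clo by (rule closure_minimal)
  then show ?thesis
    using a l by auto
qed

lemma ptval_eq:
  fixes f g :: "real \<Rightarrow> 'a::euclidean_space"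
  assumes l: "l > 0" and g: "continuous_on {0..l} g"
    and ae: "AE s in lebesgue_on {0<..<l}. g s = f s" and a: "a \<in> {0..l}"
  shows "ptval l f a = g a"
  unfolding ptval_def
proof (rule the_equality)
  show "\<exists>g'. continuous_on {0..l} g' \<and> (AE s in lebesgue_on {0<..<l}. g' s = f s) \<and> g' a = g a"
    using g ae by blast
  fix v assume "\<exists>g'. continuous_on {0..l} g' \<and> (AE s in lebesgue_on {0<..<l}. g' s = f s) \<and> g' a = v"
  then obtain g' where g': "continuous_on {0..l} g'" "AE s in lebesgue_on {0<..<l}. g' s = f s" "g' a = v"
    by blast
  from g'(2) ae have "AE s in lebesgue_on {0<..<l}. g' s = g s"
    by eventually_elim simp
  from continuous_AE_eq_imp_eq[OF l g'(1) g this a] g'(3) show "v = g a" by simp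
qed

lemma ptval_cong_AE:
  assumes "AE s in lebesgue_on {0<..<l}. f s = g s"
  shows "ptval l f = ptval l g"
proof -
  have "(AE s in lebesgue_on {0<..<l}. h s = f s) \<longleftrightarrow> (AE s in lebesgue_on {0<..<l}. h s = g s)" for h
  proof
    assume "AE s in lebesgue_on {0<..<l}. h s = f s"
    with assms show "AE s in lebesgue_on {0<..<l}. h s = g s" by eventually_elim simp
  next
    assume "AE s in lebesgue_on {0<..<l}. h s = g s"
    with assms show "AE s in lebesgue_on {0<..<l}. h s = f s" by eventually_elim simp
  qed
  then show ?thesis
    by (simp add: ptval_def[abs_def])
qed

text \<open>
  The source of all regularity of \<open>dval\<close>: an indefinite integral is continuous, and it is
  differentiable as soon as the integrand has a continuous representative.
\<close>

lemma dval_indefinite_integral: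
  assumes l: "l > 0" and f: "f \<in> Hs l m" and k: "k < m"
  shows "\<exists>c. (\<forall>s\<in>{0..l}. dval l k f s = c + integral {0..s} (wderiv l (Suc k) f)) \<and>
    (AE s in lebesgue_on {0<..<l}. dval l k f s = wderiv l k f s)"
proof -
  have L2: "wderiv l (Suc k) f \<in> L2 l" "wderiv l k f \<in> L2 l"
    using Hs_wderiv(1)[OF f] k by auto
  have "has_weak_deriv l 1 (wderiv l k f) (wderiv l (Suc k) f)"
    by (rule has_weak_deriv_step[OF Hs_wderiv(2)[OF f] Hs_wderiv(2)[OF f]]) (use k in simp_all)
  from weak_deriv_imp_indefinite_integral[OF l L2(2,1) this] obtain c where
    c: "AE s in lebesgue_on {0<..<l}. wderiv l k f s = c + integral {0..s} (wderiv l (Suc k) f)" ..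
  have eq: "dval l k f s = c + integral {0..s} (wderiv l (Suc k) f)" if "s \<in> {0..l}" for s
  proof (rule ptval_eq[OF l _ _ that])
    show "continuous_on {0..l} (\<lambda>s. c + integral {0..s} (wderiv l (Suc k) f))"
      by (intro continuous_intros indefinite_integral_continuous(2) L2_imp_integrable L2)
    show "AE s in lebesgue_on {0<..<l}. c + integral {0..s} (wderiv l (Suc k) f) = wderiv l k f s"
      using c by eventually_elim simp
  qed
  moreover have "AE s in lebesgue_on {0<..<l}. dval l k f s = wderiv l k f s"
    using c AE_space by eventually_elim (auto simp: eq)
  ultimately show ?thesis by blast
qed

lemma
  assumes l: "l > 0" and f: "f \<in> Hs l m" and k: "k < m"
  shows dval_continuous: "continuous_on {0..l} (dval l k f)"
    and dval_AE: "AE s in lebesgue_on {0<..<l}. dval l k f s = wderiv l k f s"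
proof -
  obtain c where c: "\<And>s. s \<in> {0..l} \<Longrightarrow> dval l k f s = c + integral {0..s} (wderiv l (Suc k) f)"
    "AE s in lebesgue_on {0<..<l}. dval l k f s = wderiv l k f s"
    using dval_indefinite_integral[OF assms] by blast
  have "wderiv l (Suc k) f \<in> L2 l" using Hs_wderiv(1)[OF f] k by simp
  then have "continuous_on {0..l} (\<lambda>s. c + integral {0..s} (wderiv l (Suc k) f))"
    by (intro continuous_intros indefinite_integral_continuous(2) L2_imp_integrable)
  then show "continuous_on {0..l} (dval l k f)"
    using c(1) by (simp cong: continuous_on_cong_simp)
  show "AE s in lebesgue_on {0<..<l}. dval l k f s = wderiv l k f s" by fact
qed

text \<open>
  If a further derivative is available, the integrand in \<open>dval_indefinite_integral\<close> may be replaced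
  by its continuous representative, and the fundamental theorem of calculus applies.
\<close>

lemma dval_has_vector_derivative:
  assumes l: "l > 0" and f: "f \<in> Hs l m" and k: "Suc k < m" and s: "s \<in> {0..l}"
  shows "(dval l k f has_vector_derivative dval l (Suc k) f s) (at s within {0..l})"
proof -
  obtain c where c: "\<And>s. s \<in> {0..l} \<Longrightarrow> dval l k f s = c + integral {0..s} (wderiv l (Suc k) f)"
    using dval_indefinite_integral[OF l f Suc_lessD[OF k]] by blast
  note cont = dval_continuous[OF l f k]
  have "AE s in lebesgue_on {0<..<l}. dval l (Suc k) f s = wderiv l (Suc k) f s"
    by (rule dval_AE[OF l f k])
  then have "AE s in lebesgue. s \<in> {0<..<l} \<longrightarrow> dval l (Suc k) f s = wderiv l (Suc k) f s"
    by (subst (asm) AE_restrict_space_iff) auto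
  then obtain N where N: "N \<in> null_sets lebesgue"
    "{s. \<not> (s \<in> {0<..<l} \<longrightarrow> dval l (Suc k) f s = wderiv l (Suc k) f s)} \<subseteq> N"
    by (auto simp: eventually_ae_filter)
  have "integral {0..s} (wderiv l (Suc k) f) = integral {0..s} (dval l (Suc k) f)" if "s \<in> {0..l}" for s
  proof (rule integral_spike)
    show "negligible (N \<union> {0, l})"
      using N(1) by (intro negligible_Un negligible_finite[of "{0, l}"]) (simp_all add: negligible_iff_null_sets)
    fix x assume "x \<in> {0..s} - (N \<union> {0, l})"
    then have "x \<in> {0<..<l}" "x \<notin> N" using that by auto
    then show "dval l (Suc k) f x = wderiv l (Suc k) f x"
      using N(2) by blast
  qed
  then have "dval l k f u = c + integral {0..u} (dval l (Suc k) f)" if "u \<in> {0..l}" for u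
    using c that by simp
  moreover have "((\<lambda>u. c + integral {0..u} (dval l (Suc k) f)) has_vector_derivative dval l (Suc k) f s)
      (at s within {0..l})"
    using has_vector_derivative_add[OF has_vector_derivative_const[of c]
        integral_has_vector_derivative[OF cont s]] by simp
  ultimately show ?thesis
    by (rule has_vector_derivative_transform[OF s])
qed

lemma dval_0:
  assumes "f \<in> L2 l"
  shows "dval l 0 f = ptval l f"
  by (rule ptval_cong_AE) (rule wderiv_unique[OF assms has_weak_deriv_0])

lemma ptval_AE:
  assumes l: "l > 0" and f: "f \<in> Hs l m" and m: "0 < m"
  shows "AE s in lebesgue_on {0<..<l}. ptval l f s = f s"
proof -
  have L2: "f \<in> L2 l" using f by (simp add: Hs_def)
  show ?thesis
    using dval_AE[OF l f m] wderiv_unique[OF L2 has_weak_deriv_0]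
    by eventually_elim (simp add: dval_0[OF L2])
qed

lemma dval_Suc_eq_0:
  assumes l: "l > 0" and f: "f \<in> Hs l m" and k: "Suc k < m"
    and const: "\<And>s. s \<in> {0<..<l} \<Longrightarrow> dval l k f s = c" and s: "s \<in> {0..l}"
  shows "dval l (Suc k) f s = 0"
proof (rule continuous_AE_eq_imp_eq[OF l dval_continuous[OF l f k] continuous_on_const _ s])
  have "dval l (Suc k) f s = 0" if s: "s \<in> {0<..<l}" for s
  proof -
    have "(dval l k f has_vector_derivative dval l (Suc k) f s) (at s)"
      using dval_has_vector_derivative[OF l f k, of s] s at_within_Icc_at[of 0 s l] by simp
    moreover have "(dval l k f has_vector_derivative 0) (at s)"
      by (rule has_vector_derivative_transform_within_open[OF has_vector_derivative_const[of c], of "{0<..<l}"])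
         (use s const in auto)
    ultimately show ?thesis by (rule vector_derivative_unique_at)
  qed
  then show "AE s in lebesgue_on {0<..<l}. dval l (Suc k) f s = 0"
    by (intro AE_I2) simp
qed

lemma dval_const:
  assumes l: "l > 0" and f: "f \<in> Hs l m" and k: "Suc k < m"
    and zero: "\<And>s. s \<in> {0..l} \<Longrightarrow> dval l (Suc k) f s = 0"
  shows "\<exists>c. \<forall>s\<in>{0..l}. dval l k f s = c"
proof -
  have "(dval l k f has_vector_derivative 0) (at s within {0..l})" if "s \<in> {0..l}" for s
    using dval_has_vector_derivative[OF l f k that] zero[OF that] by simp
  then obtain c where "\<And>s. s \<in> {0..l} \<Longrightarrow> dval l k f s = c"
    using has_vector_derivative_zero_constant[of "{0..l}" "dval l k f"] by (auto simp: convex_real_interval)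
  then show ?thesis by blast
qed

text \<open>
  Functions that agree almost everywhere have the same weak derivatives, so the choice made by
  \<open>wderiv\<close> is the same for both.
\<close>

lemma wderiv_cong_AE:
  assumes "AE s in lebesgue_on {0<..<l}. f s = g s" "f \<in> borel_measurable (lebesgue_on {0<..<l})"
    "g \<in> borel_measurable (lebesgue_on {0<..<l})"
  shows "wderiv l k f = wderiv l k g"
proof -
  have "(LINT s|lebesgue_on {0<..<l}. (deriv ^^ k) \<eta> s *\<^sub>R f s) =
        (LINT s|lebesgue_on {0<..<l}. (deriv ^^ k) \<eta> s *\<^sub>R g s)" if "\<eta> \<in> test_functions l" for \<eta>
  proof (rule integral_cong_AE)
    have "(deriv ^^ k) \<eta> \<in> borel_measurable (lebesgue_on {0<..<l})"
      by (intro continuous_imp_measurable_on_sets_lebesgue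
          test_functions_continuous[OF deriv_funpow_test_functions[OF that]]) simp
    with assms(2,3) show "(\<lambda>s. (deriv ^^ k) \<eta> s *\<^sub>R f s) \<in> borel_measurable (lebesgue_on {0<..<l})"
      "(\<lambda>s. (deriv ^^ k) \<eta> s *\<^sub>R g s) \<in> borel_measurable (lebesgue_on {0<..<l})"
      by simp_all
    show "AE s in lebesgue_on {0<..<l}. (deriv ^^ k) \<eta> s *\<^sub>R f s = (deriv ^^ k) \<eta> s *\<^sub>R g s"
      using assms(1) by eventually_elim simp
  qed
  then have "has_weak_deriv l k f = has_weak_deriv l k g"
    by (simp add: fun_eq_iff has_weak_deriv_def)
  then show ?thesis by (simp add: wderiv_def)
qed

section \<open>Linear combinations and smooth functions\<close>

lemma L2_lincomb:
  assumes f: "f \<in> L2 l" and g: "g \<in> L2 l"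
  shows "(\<lambda>s. p *\<^sub>R f s + q *\<^sub>R g s) \<in> L2 l"
proof -
  have m: "f \<in> borel_measurable (lebesgue_on {0<..<l})" "g \<in> borel_measurable (lebesgue_on {0<..<l})"
    and i: "integrable (lebesgue_on {0<..<l}) (\<lambda>s. (norm (f s))\<^sup>2)"
    "integrable (lebesgue_on {0<..<l}) (\<lambda>s. (norm (g s))\<^sup>2)"
    using f g by (auto simp: L2_def)
  have mc: "(\<lambda>s. p *\<^sub>R f s + q *\<^sub>R g s) \<in> borel_measurable (lebesgue_on {0<..<l})"
    using m by simp
  have bound: "(norm (p *\<^sub>R u + q *\<^sub>R v))\<^sup>2 \<le> 2 * p\<^sup>2 * (norm u)\<^sup>2 + 2 * q\<^sup>2 * (norm v)\<^sup>2" for u v :: 'a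
  proof -
    have "(norm (p *\<^sub>R u + q *\<^sub>R v))\<^sup>2 \<le> (norm (p *\<^sub>R u) + norm (q *\<^sub>R v))\<^sup>2"
      by (intro power_mono norm_triangle_ineq) simp
    also have "\<dots> \<le> 2 * (norm (p *\<^sub>R u))\<^sup>2 + 2 * (norm (q *\<^sub>R v))\<^sup>2"
      using zero_le_power2[of "norm (p *\<^sub>R u) - norm (q *\<^sub>R v)"]
      by (simp only: power2_diff power2_sum)
    finally show ?thesis by (simp add: power_mult_distrib)
  qed
  have "integrable (lebesgue_on {0<..<l}) (\<lambda>s. (norm (p *\<^sub>R f s + q *\<^sub>R g s))\<^sup>2)"
  proof (rule Bochner_Integration.integrable_bound)
    show "integrable (lebesgue_on {0<..<l}) (\<lambda>s. 2 * p\<^sup>2 * (norm (f s))\<^sup>2 + 2 * q\<^sup>2 * (norm (g s))\<^sup>2)"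
      using i by simp
    show "(\<lambda>s. (norm (p *\<^sub>R f s + q *\<^sub>R g s))\<^sup>2) \<in> borel_measurable (lebesgue_on {0<..<l})"
      using mc by simp
    show "AE s in lebesgue_on {0<..<l}. norm ((norm (p *\<^sub>R f s + q *\<^sub>R g s))\<^sup>2)
        \<le> norm (2 * p\<^sup>2 * (norm (f s))\<^sup>2 + 2 * q\<^sup>2 * (norm (g s))\<^sup>2)"
      using bound by (intro AE_I2) (simp add: order_trans[OF _ abs_ge_self])
  qed
  with mc show ?thesis by (simp add: L2_def)
qed

lemma has_weak_deriv_lincomb:
  assumes "f \<in> L2 l" "g \<in> L2 l" "f' \<in> L2 l" "g' \<in> L2 l"
    and f: "has_weak_deriv l k f f'" and g: "has_weak_deriv l k g g'"
  shows "has_weak_deriv l k (\<lambda>s. p *\<^sub>R f s + q *\<^sub>R g s) (\<lambda>s. p *\<^sub>R f' s + q *\<^sub>R g' s)"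
  unfolding has_weak_deriv_def
proof
  fix \<eta> assume \<eta>: "\<eta> \<in> test_functions l"
  let ?I = "\<lambda>f. LINT s|lebesgue_on {0<..<l}. f s"
  have lin: "?I (\<lambda>s. \<zeta> s *\<^sub>R (p *\<^sub>R f s + q *\<^sub>R g s)) =
      p *\<^sub>R ?I (\<lambda>s. \<zeta> s *\<^sub>R f s) + q *\<^sub>R ?I (\<lambda>s. \<zeta> s *\<^sub>R g s)"
    if "\<zeta> \<in> test_functions l" "f \<in> L2 l" "g \<in> L2 l" for \<zeta> and f g :: "real \<Rightarrow> 'a"
  proof -
    have "?I (\<lambda>s. \<zeta> s *\<^sub>R (p *\<^sub>R f s + q *\<^sub>R g s)) = ?I (\<lambda>s. p *\<^sub>R (\<zeta> s *\<^sub>R f s) + q *\<^sub>R (\<zeta> s *\<^sub>R g s))"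
      by (simp add: scaleR_right_distrib mult.commute)
    also have "\<dots> = ?I (\<lambda>s. p *\<^sub>R (\<zeta> s *\<^sub>R f s)) + ?I (\<lambda>s. q *\<^sub>R (\<zeta> s *\<^sub>R g s))"
      by (intro Bochner_Integration.integral_add integrable_scaleR_right integrable_test_scaleR that)
    finally show ?thesis by (simp only: integral_scaleR_right)
  qed
  have "?I (\<lambda>s. (deriv ^^ k) \<eta> s *\<^sub>R (p *\<^sub>R f s + q *\<^sub>R g s)) =
      p *\<^sub>R ?I (\<lambda>s. (deriv ^^ k) \<eta> s *\<^sub>R f s) + q *\<^sub>R ?I (\<lambda>s. (deriv ^^ k) \<eta> s *\<^sub>R g s)"
    by (rule lin[OF deriv_funpow_test_functions[OF \<eta>] assms(1,2)])
  also have "\<dots> = p *\<^sub>R ((- 1) ^ k *\<^sub>R ?I (\<lambda>s. \<eta> s *\<^sub>R f' s)) + q *\<^sub>R ((- 1) ^ k *\<^sub>R ?I (\<lambda>s. \<eta> s *\<^sub>R g' s))"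
    using bspec[OF f[unfolded has_weak_deriv_def] \<eta>] bspec[OF g[unfolded has_weak_deriv_def] \<eta>] by simp
  also have "\<dots> = (- 1) ^ k *\<^sub>R ?I (\<lambda>s. \<eta> s *\<^sub>R (p *\<^sub>R f' s + q *\<^sub>R g' s))"
    unfolding lin[OF \<eta> assms(3,4)] by (simp add: scaleR_right_distrib mult.commute)
  finally show "?I (\<lambda>s. (deriv ^^ k) \<eta> s *\<^sub>R (p *\<^sub>R f s + q *\<^sub>R g s)) =
     (- 1) ^ k *\<^sub>R ?I (\<lambda>s. \<eta> s *\<^sub>R (p *\<^sub>R f' s + q *\<^sub>R g' s))" .
qed

lemma
  assumes f: "f \<in> Hs l m" and g: "g \<in> Hs l m"
  shows Hs_lincomb: "(\<lambda>s. p *\<^sub>R f s + q *\<^sub>R g s) \<in> Hs l m"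
    and dval_lincomb: "\<lbrakk>l > 0; k < m; a \<in> {0..l}\<rbrakk> \<Longrightarrow>
      dval l k (\<lambda>s. p *\<^sub>R f s + q *\<^sub>R g s) a = p *\<^sub>R dval l k f a + q *\<^sub>R dval l k g a"
proof -
  have fg: "f \<in> L2 l" "g \<in> L2 l" using f g by (auto simp: Hs_def)
  have wd: "(\<lambda>s. p *\<^sub>R wderiv l k f s + q *\<^sub>R wderiv l k g s) \<in> L2 l"
    "has_weak_deriv l k (\<lambda>s. p *\<^sub>R f s + q *\<^sub>R g s) (\<lambda>s. p *\<^sub>R wderiv l k f s + q *\<^sub>R wderiv l k g s)"
    if "k \<le> m" for k
    using Hs_wderiv[OF f that] Hs_wderiv[OF g that] fg
    by (auto intro!: L2_lincomb has_weak_deriv_lincomb)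
  then show H: "(\<lambda>s. p *\<^sub>R f s + q *\<^sub>R g s) \<in> Hs l m"
    unfolding Hs_def using L2_lincomb[OF fg] by blast
  assume l: "l > 0" and k: "k < m" and a: "a \<in> {0..l}"
  show "dval l k (\<lambda>s. p *\<^sub>R f s + q *\<^sub>R g s) a = p *\<^sub>R dval l k f a + q *\<^sub>R dval l k g a"
  proof (rule ptval_eq[OF l _ _ a])
    show "continuous_on {0..l} (\<lambda>a. p *\<^sub>R dval l k f a + q *\<^sub>R dval l k g a)"
      by (intro continuous_intros dval_continuous[OF l f k] dval_continuous[OF l g k])
    show "AE s in lebesgue_on {0<..<l}. p *\<^sub>R dval l k f s + q *\<^sub>R dval l k g s =
        wderiv l k (\<lambda>s. p *\<^sub>R f s + q *\<^sub>R g s) s"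
      using wderiv_unique[OF wd[OF less_imp_le[OF k]]] dval_AE[OF l f k] dval_AE[OF l g k]
      by eventually_elim simp
  qed
qed

lemma
  assumes f: "f \<in> Hs l m" and g: "g \<in> Hs l m"
  shows Hs_diff: "(\<lambda>s. f s - g s) \<in> Hs l m"
    and dval_diff: "\<lbrakk>l > 0; k < m; a \<in> {0..l}\<rbrakk> \<Longrightarrow>
      dval l k (\<lambda>s. f s - g s) a = dval l k f a - dval l k g a"
    and Hs_add: "(\<lambda>s. f s + g s) \<in> Hs l m"
    and dval_add: "\<lbrakk>l > 0; k < m; a \<in> {0..l}\<rbrakk> \<Longrightarrow>
      dval l k (\<lambda>s. f s + g s) a = dval l k f a + dval l k g a"
  using Hs_lincomb[OF f g, of 1 "- 1"] dval_lincomb[OF f g, of k a 1 "- 1"]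
    Hs_lincomb[OF f g, of 1 1] dval_lincomb[OF f g, of k a 1 1] by simp_all

lemma
  assumes f: "f \<in> Hs l m"
  shows Hs_scaleR: "(\<lambda>s. p *\<^sub>R f s) \<in> Hs l m"
    and dval_scaleR: "\<lbrakk>l > 0; k < m; a \<in> {0..l}\<rbrakk> \<Longrightarrow> dval l k (\<lambda>s. p *\<^sub>R f s) a = p *\<^sub>R dval l k f a"
  using Hs_lincomb[OF f f, of p 0] dval_lincomb[OF f f, of k a p 0] by simp_all

lemma continuous_imp_L2:
  fixes f :: "real \<Rightarrow> 'a::euclidean_space"
  assumes "continuous_on {0..l} f" shows "f \<in> L2 l"
proof -
  have "continuous_on {0..l} (\<lambda>s. (norm (f s))\<^sup>2)"
    by (intro continuous_intros assms)
  then show ?thesis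
    using integrable_continuous_interval[OF assms] integrable_continuous_interval
    by (auto simp: L2_def)
qed

text \<open>
  Integration by parts; the boundary terms vanish with the test function.
\<close>

lemma has_weak_deriv_classical:
  fixes G :: "nat \<Rightarrow> real \<Rightarrow> 'a::euclidean_space"
  assumes l: "l > 0" and G: "\<And>k s. k \<le> m \<Longrightarrow> s \<in> {0..l} \<Longrightarrow> (G k has_vector_derivative G (Suc k) s) (at s within {0..l})"
    and cont: "\<And>k. k \<le> Suc m \<Longrightarrow> continuous_on {0..l} (G k)"
    and "k \<le> Suc m"
  shows "has_weak_deriv l k (G 0) (G k)"
  using \<open>k \<le> Suc m\<close>
proof (induction k)
  case (Suc k)
  let ?I = "\<lambda>f. LINT s|lebesgue_on {0<..<l}. f s"
  show ?case
    unfolding has_weak_deriv_def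
  proof
    fix \<eta> assume \<eta>: "\<eta> \<in> test_functions l"
    note \<eta>' = deriv_test_functions[OF \<eta>]
    have parts: "?I (\<lambda>s. deriv \<eta> s *\<^sub>R G k s) = - ?I (\<lambda>s. \<eta> s *\<^sub>R G (Suc k) s)"
    proof -
      have int: "integrable (lebesgue_on {0<..<l}) (\<lambda>s. \<zeta> s *\<^sub>R G j s)"
        if "\<zeta> \<in> test_functions l" "j \<le> Suc m" for \<zeta> j
        by (intro integrable_test_scaleR continuous_imp_L2 cont that)
      have "((\<lambda>s. \<eta> s *\<^sub>R G (Suc k) s + deriv \<eta> s *\<^sub>R G k s) has_integral
          \<eta> l *\<^sub>R G k l - \<eta> 0 *\<^sub>R G k 0) {0..l}"
        using l Suc.prems test_functions_derivative[OF \<eta>, of 0]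
        by (intro fundamental_theorem_of_calculus has_vector_derivative_scaleR G)
           (auto intro: has_field_derivative_at_within)
      moreover have "\<eta> l = 0" "\<eta> 0 = 0"
        using test_functions_vanish[OF \<eta>] by auto
      moreover have "integrable (lebesgue_on {0<..<l}) (\<lambda>s. \<eta> s *\<^sub>R G (Suc k) s + deriv \<eta> s *\<^sub>R G k s)"
        using Suc.prems by (intro Bochner_Integration.integrable_add int \<eta> \<eta>') auto
      ultimately have "?I (\<lambda>s. \<eta> s *\<^sub>R G (Suc k) s + deriv \<eta> s *\<^sub>R G k s) = 0"
        by (simp add: integral_interval_eq integral_unique)
      moreover have "?I (\<lambda>s. \<eta> s *\<^sub>R G (Suc k) s + deriv \<eta> s *\<^sub>R G k s) =
          ?I (\<lambda>s. \<eta> s *\<^sub>R G (Suc k) s) + ?I (\<lambda>s. deriv \<eta> s *\<^sub>R G k s)"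
        using Suc.prems by (intro Bochner_Integration.integral_add int \<eta> \<eta>') auto
      ultimately show ?thesis by (simp add: add_eq_0_iff)
    qed
    have "has_weak_deriv l k (G 0) (G k)" using Suc by simp
    from bspec[OF this[unfolded has_weak_deriv_def] \<eta>']
    show "?I (\<lambda>s. (deriv ^^ Suc k) \<eta> s *\<^sub>R G 0 s) = (- 1) ^ Suc k *\<^sub>R ?I (\<lambda>s. \<eta> s *\<^sub>R G (Suc k) s)"
      by (simp add: funpow_swap1 parts)
  qed
qed (simp add: has_weak_deriv_0)

lemma
  fixes G :: "nat \<Rightarrow> real \<Rightarrow> 'a::euclidean_space"
  assumes l: "l > 0" and G: "\<And>k s. (G k has_vector_derivative G (Suc k) s) (at s)"
  shows smooth_imp_Hs: "G 0 \<in> Hs l m"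
    and dval_smooth: "a \<in> {0..l} \<Longrightarrow> dval l k (G 0) a = G k a"
proof -
  have cont: "continuous_on {0..l} (G k)" for k
    using G by (auto intro!: continuous_at_imp_continuous_on has_vector_derivative_continuous)
  have wd: "has_weak_deriv l k (G 0) (G k)" for k
    by (rule has_weak_deriv_classical[OF l, where m = k])
       (auto intro: cont has_vector_derivative_at_within G)
  show "G 0 \<in> Hs l m"
    using wd cont by (auto simp: Hs_def intro!: continuous_imp_L2 bexI[of _ "G _"])
  assume a: "a \<in> {0..l}"
  show "dval l k (G 0) a = G k a"
    using eventually_mono[OF wderiv_unique[OF continuous_imp_L2[OF cont] wd], OF sym]
    by (intro ptval_eq[OF l cont _ a])
qed

section \<open>Sobolev norms and the Sobolev inequality\<close>

lemma L2norm_power2: "(L2norm l f)\<^sup>2 = (LINT s|lebesgue_on {0<..<l}. (norm (f s))\<^sup>2)"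
  by (simp add: L2norm_def integral_nonneg_AE)

lemma L2norm_wderiv:
  assumes l: "l > 0" and f: "f \<in> Hs l m" and k: "k < m"
  shows "(L2norm l (wderiv l k f))\<^sup>2 = integral {0..l} (\<lambda>s. (norm (dval l k f s))\<^sup>2)"
proof -
  have c: "continuous_on {0..l} (\<lambda>s. (norm (dval l k f s))\<^sup>2)"
    by (intro continuous_intros dval_continuous[OF l f k])
  have "wderiv l k f \<in> L2 l" using Hs_wderiv(1)[OF f] k by simp
  then have "(LINT s|lebesgue_on {0<..<l}. (norm (wderiv l k f s))\<^sup>2) =
      (LINT s|lebesgue_on {0<..<l}. (norm (dval l k f s))\<^sup>2)"
    using dval_AE[OF l f k] integrable_continuous_interval[OF c]
    by (intro integral_cong_AE) (auto simp: L2_def elim: eventually_mono)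
  then show ?thesis
    by (simp add: L2norm_power2 integral_interval_eq[OF integrable_continuous_interval[OF c]])
qed

lemma L2norm_le_Hnorm: "k \<le> m \<Longrightarrow> (L2norm l (wderiv l k f))\<^sup>2 \<le> (Hnorm l m f)\<^sup>2"
  unfolding Hnorm_def
  using member_le_sum[of k "{..m}" "\<lambda>k. (L2norm l (wderiv l k f))\<^sup>2"] by (simp add: sum_nonneg)

lemma Hnorm_mono: "m' \<le> m \<Longrightarrow> Hnorm l m' f \<le> Hnorm l m f"
  unfolding Hnorm_def by (intro real_sqrt_le_mono sum_mono2) auto

lemma Hnorm_nonneg: "0 \<le> Hnorm l m f"
  by (simp add: Hnorm_def sum_nonneg)

lemma Hnorm_0:
  assumes "f \<in> L2 l" shows "(Hnorm l 0 f)\<^sup>2 = (LINT s|lebesgue_on {0<..<l}. (norm (f s))\<^sup>2)"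
proof -
  have "f \<in> Hs l 0"
    using assms has_weak_deriv_0 by (auto simp: Hs_def)
  then have "wderiv l 0 f \<in> L2 l" by (rule Hs_wderiv) simp
  then have "(LINT s|lebesgue_on {0<..<l}. (norm (wderiv l 0 f s))\<^sup>2) = (LINT s|lebesgue_on {0<..<l}. (norm (f s))\<^sup>2)"
    using assms wderiv_unique[OF assms has_weak_deriv_0]
    by (intro integral_cong_AE) (auto simp: L2_def elim: eventually_mono)
  then show ?thesis
    by (simp add: Hnorm_def L2norm_power2 integral_nonneg_AE)
qed

text \<open>
  The value at \<open>a\<close> differs from the value at any \<open>s\<close> by at most \<open>A = \<integral> |f\<^bsup>(k+1)\<^esup>|\<close>, and
  \<open>A\<^sup>2 \<le> l \<parallel>f\<^bsup>(k+1)\<^esup>\<parallel>\<^sup>2\<close>. Averaging \<open>|f\<^bsup>(k)\<^esup>(a)|\<^sup>2 \<le> 2 |f\<^bsup>(k)\<^esup>(s)|\<^sup>2 + 2 A\<^sup>2\<close> over \<open>s\<close> gives the bound.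
\<close>

lemma sobolev_embedding:
  assumes l: "l > 0" and f: "f \<in> Hs l m" and k: "k < m" and a: "a \<in> {0..l}"
  shows "norm (dval l k f a) \<le> sqrt (2 / l + 2 * l) * Hnorm l m f"
proof -
  define h where "h = wderiv l (Suc k) f"
  have hL2: "h \<in> L2 l" using Hs_wderiv(1)[OF f] k by (simp add: h_def)
  note hI = L2_imp_integrable[OF hL2]
  have hI2: "integrable (lebesgue_on {0<..<l}) (\<lambda>s. (norm (h s))\<^sup>2)" using hL2 by (simp add: L2_def)
  define A where "A = (LINT s|lebesgue_on {0<..<l}. norm (h s))"
  have A0: "0 \<le> A" by (simp add: A_def)
  have one: "(LINT s|lebesgue_on {0<..<l}. (1::real)) = l"
    using integral_interval_eq[OF integrable_continuous_interval[of l "\<lambda>_. 1 :: real"]] l by simp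
  interpret finite_measure "lebesgue_on {0<..<l}" by (rule finite_measure_interval)
  \<comment> \<open>Cauchy-Schwarz on an interval: the variance of \<open>|h|\<close> is nonnegative.\<close>
  have "0 \<le> (LINT s|lebesgue_on {0<..<l}. (norm (h s) - A / l)\<^sup>2)"
    by simp
  also have "\<dots> = (LINT s|lebesgue_on {0<..<l}. (norm (h s))\<^sup>2 - (2 * A / l) * norm (h s) + (A / l)\<^sup>2 * 1)"
    by (simp add: power2_diff algebra_simps)
  also have "\<dots> = (LINT s|lebesgue_on {0<..<l}. (norm (h s))\<^sup>2) - (2 * A / l) * A + (A / l)\<^sup>2 * l"
  proof -
    have "(LINT s|lebesgue_on {0<..<l}. (norm (h s))\<^sup>2 - (2 * A / l) * norm (h s) + (A / l)\<^sup>2 * 1)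
       = (LINT s|lebesgue_on {0<..<l}. (norm (h s))\<^sup>2) - (LINT s|lebesgue_on {0<..<l}. (2 * A / l) * norm (h s))
         + (LINT s|lebesgue_on {0<..<l}. (A / l)\<^sup>2 * 1)"
      using hI2 hI by (subst Bochner_Integration.integral_add Bochner_Integration.integral_diff; simp)+
    also have "\<dots> = (LINT s|lebesgue_on {0<..<l}. (norm (h s))\<^sup>2) - (2 * A / l) * A + (A / l)\<^sup>2 * l"
      unfolding integral_mult_right_zero one A_def[symmetric] ..
    finally show ?thesis .
  qed
  also have "\<dots> = (L2norm l h)\<^sup>2 - A\<^sup>2 / l"
    unfolding L2norm_power2 using l by (simp add: power2_eq_square field_simps)
  finally have A2: "A\<^sup>2 \<le> l * (L2norm l h)\<^sup>2"
    using l by (simp add: field_simps)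
  obtain c where c: "\<And>s. s \<in> {0..l} \<Longrightarrow> dval l k f s = c + integral {0..s} h"
    using dval_indefinite_integral[OF l f k] unfolding h_def by blast
  have hi: "h integrable_on {0..l}" "(\<lambda>s. norm (h s)) integrable_on {0..l}"
    using indefinite_integral_continuous(1)[OF hI] indefinite_integral_continuous(1)[of l "\<lambda>s. norm (h s)"] hI
    by auto
  have diff_le: "norm (dval l k f v - dval l k f u) \<le> A" if "0 \<le> u" "u \<le> v" "v \<le> l" for u v
  proof -
    have "h integrable_on {0..v}"
      by (rule integrable_on_subinterval[OF hi(1)]) (use that in auto)
    then have "integral {0..u} h + integral {u..v} h = integral {0..v} h"
      using that by (intro Henstock_Kurzweil_Integration.integral_combine) auto
    then have "dval l k f v - dval l k f u = integral {u..v} h"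
      using that c[of u] c[of v] by (simp add: algebra_simps)
    also have "norm (integral {u..v} h) \<le> integral {u..v} (\<lambda>s. norm (h s))"
      using that by (intro integral_norm_bound_integral integrable_on_subinterval[OF hi(1)]
          integrable_on_subinterval[OF hi(2)]) auto
    also have "\<dots> \<le> integral {0..l} (\<lambda>s. norm (h s))"
      using that by (intro integral_subset_le integrable_on_subinterval[OF hi(2)]) (auto intro: hi)
    also have "\<dots> = A"
      unfolding A_def using hI by (subst integral_interval_eq) auto
    finally show ?thesis .
  qed
  have pt: "(norm (dval l k f a))\<^sup>2 \<le> 2 * (norm (dval l k f s))\<^sup>2 + 2 * A\<^sup>2" if "s \<in> {0..l}" for s
  proof -
    have "norm (dval l k f a - dval l k f s) \<le> A"
      using diff_le[of a s] diff_le[of s a] a that by (cases "a \<le> s") (auto simp: norm_minus_commute)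
    then have "norm (dval l k f a) \<le> norm (dval l k f s) + A"
      using norm_triangle_sub[of "dval l k f a" "dval l k f s"] by linarith
    then have "(norm (dval l k f a))\<^sup>2 \<le> (norm (dval l k f s) + A)\<^sup>2"
      by (intro power_mono) auto
    also have "\<dots> \<le> 2 * (norm (dval l k f s))\<^sup>2 + 2 * A\<^sup>2"
      using zero_le_power2[of "norm (dval l k f s) - A"] by (simp only: power2_diff power2_sum)
    finally show ?thesis .
  qed
  have c2: "continuous_on {0..l} (\<lambda>s. (norm (dval l k f s))\<^sup>2)"
    by (intro continuous_intros dval_continuous[OF l f k])
  have "integral {0..l} (\<lambda>_. (norm (dval l k f a))\<^sup>2) \<le> integral {0..l} (\<lambda>s. 2 * (norm (dval l k f s))\<^sup>2 + 2 * A\<^sup>2)"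
    using pt by (intro integral_le integrable_continuous_real continuous_intros c2) auto
  also have "\<dots> = 2 * integral {0..l} (\<lambda>s. (norm (dval l k f s))\<^sup>2) + 2 * A\<^sup>2 * l"
    using l integrable_continuous_real[OF c2] by (subst Henstock_Kurzweil_Integration.integral_add) auto
  also have "integral {0..l} (\<lambda>s. (norm (dval l k f s))\<^sup>2) = (L2norm l (wderiv l k f))\<^sup>2"
    by (rule L2norm_wderiv[OF l f k, symmetric])
  finally have "l * (norm (dval l k f a))\<^sup>2 \<le> 2 * (L2norm l (wderiv l k f))\<^sup>2 + 2 * A\<^sup>2 * l"
    using l by simp
  also have "\<dots> \<le> 2 * (Hnorm l m f)\<^sup>2 + 2 * (l * (Hnorm l m f)\<^sup>2) * l"
  proof -
    have "A\<^sup>2 \<le> l * (Hnorm l m f)\<^sup>2"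
      using A2 L2norm_le_Hnorm[of "Suc k" m l f] k l unfolding h_def
      by (meson Suc_leI mult_left_mono order_trans less_imp_le)
    then show ?thesis
      using L2norm_le_Hnorm[of k m l f] k l by (intro add_mono mult_left_mono mult_right_mono) auto
  qed
  finally have "(norm (dval l k f a))\<^sup>2 \<le> (2 / l + 2 * l) * (Hnorm l m f)\<^sup>2"
    using l by (simp add: field_simps power2_eq_square)
  moreover have "0 \<le> Hnorm l m f" by (simp add: Hnorm_def sum_nonneg)
  ultimately show ?thesis
    using l by - (rule power2_le_imp_le, simp_all add: power_mult_distrib)
qed

text \<open>
  This carries continuity and differentiability in time, which are defined with Sobolev norms, over
  to continuous representatives.
\<close>

lemma uniform_limit_dval:
  assumes l: "l > 0" and k: "k < m" and u: "\<forall>\<^sub>F r in F. u r \<in> Hs l m"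
    and lim: "((\<lambda>r. Hnorm l m (u r)) \<longlongrightarrow> 0) F"
  shows "uniform_limit {0..l} (\<lambda>r s. dval l k (u r) s) (\<lambda>_. 0) F"
proof (rule uniform_limitI)
  fix e :: real assume "e > 0"
  have "((\<lambda>r. sqrt (2 / l + 2 * l) * Hnorm l m (u r)) \<longlongrightarrow> sqrt (2 / l + 2 * l) * 0) F"
    by (intro tendsto_intros lim)
  then have "\<forall>\<^sub>F r in F. sqrt (2 / l + 2 * l) * Hnorm l m (u r) < e"
    using \<open>e > 0\<close> by (auto dest: order_tendstoD)
  then show "\<forall>\<^sub>F r in F. \<forall>s\<in>{0..l}. dist (dval l k (u r) s) 0 < e"
    using u
  proof eventually_elim
    case (elim r)
    then show ?case
      using le_less_trans[OF sobolev_embedding[OF l elim(2) k] elim(1)] by simp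
  qed
qed

section \<open>Sobolev-valued functions of time\<close>

lemma has_time_deriv_mono:
  assumes u: "has_time_deriv l m u w t" and m: "m' \<le> m"
  shows "has_time_deriv l m' u w t"
proof -
  have lim: "((\<lambda>h. Hnorm l m (\<lambda>s. (u (t + h) s - u t s) /\<^sub>R h - w s)) \<longlongrightarrow> 0) (at 0 within {- t..})"
    using u by (simp add: has_time_deriv_def)
  have "((\<lambda>h. Hnorm l m' (\<lambda>s. (u (t + h) s - u t s) /\<^sub>R h - w s)) \<longlongrightarrow> 0) (at 0 within {- t..})"
    by (rule tendsto_sandwich[OF _ _ tendsto_const lim]) (simp_all add: Hnorm_nonneg Hnorm_mono[OF m])
  then show ?thesis
    using u m by (auto simp: has_time_deriv_def intro: Hs_mono)
qed

text \<open>
  The distance of the two candidates is bounded by the distances of both from the difference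
  quotient, which become arbitrarily small.
\<close>

lemma has_time_deriv_unique:
  assumes w: "has_time_deriv l 0 u w t" and v: "has_time_deriv l 0 u v t" and t: "t \<ge> 0"
  shows "AE s in lebesgue_on {0<..<l}. w s = v s"
proof -
  have H: "u r \<in> Hs l 0" if "r \<ge> 0" for r using w that by (simp add: has_time_deriv_def)
  have wv: "w \<in> Hs l 0" "v \<in> Hs l 0" using w v by (simp_all add: has_time_deriv_def)
  define q where "q h = (\<lambda>s. (u (t + h) s - u t s) /\<^sub>R h)" for h
  have q: "q h \<in> Hs l 0" if "h \<ge> - t" for h
    unfolding q_def using that t by (intro Hs_scaleR Hs_diff H) auto
  define D where "D = (LINT s|lebesgue_on {0<..<l}. (norm (w s - v s))\<^sup>2)"
  have L2: "f \<in> L2 l" if "f \<in> Hs l 0" for f :: "real \<Rightarrow> 'a" using that by (simp add: Hs_def)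
  have int: "integrable (lebesgue_on {0<..<l}) (\<lambda>s. (norm (f s - g s))\<^sup>2)"
    if "f \<in> Hs l 0" "g \<in> Hs l 0" for f g :: "real \<Rightarrow> 'a"
    using L2[OF Hs_diff[OF that]] by (simp add: L2_def)
  have "D \<le> 2 * (Hnorm l 0 (\<lambda>s. q h s - w s))\<^sup>2 + 2 * (Hnorm l 0 (\<lambda>s. q h s - v s))\<^sup>2" if "h \<ge> - t" for h
  proof -
    have "D \<le> (LINT s|lebesgue_on {0<..<l}. 2 * (norm (q h s - w s))\<^sup>2 + 2 * (norm (q h s - v s))\<^sup>2)"
      unfolding D_def
    proof (rule Bochner_Integration.integral_mono)
      fix s
      have "norm (w s - v s) \<le> norm (q h s - w s) + norm (q h s - v s)"
        using norm_triangle_ineq4[of "q h s - v s" "q h s - w s"] by simp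
      then have "(norm (w s - v s))\<^sup>2 \<le> (norm (q h s - w s) + norm (q h s - v s))\<^sup>2"
        by (intro power_mono) auto
      also have "\<dots> \<le> 2 * (norm (q h s - w s))\<^sup>2 + 2 * (norm (q h s - v s))\<^sup>2"
        using zero_le_power2[of "norm (q h s - w s) - norm (q h s - v s)"] by (simp only: power2_diff power2_sum)
      finally show "(norm (w s - v s))\<^sup>2 \<le> 2 * (norm (q h s - w s))\<^sup>2 + 2 * (norm (q h s - v s))\<^sup>2" .
    qed (use int[OF wv] int[OF q[OF that] wv(1)] int[OF q[OF that] wv(2)] in auto)
    also have "\<dots> = 2 * (Hnorm l 0 (\<lambda>s. q h s - w s))\<^sup>2 + 2 * (Hnorm l 0 (\<lambda>s. q h s - v s))\<^sup>2"
      using int[OF q[OF that] wv(1)] int[OF q[OF that] wv(2)]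
      by (simp add: Hnorm_0[OF L2[OF Hs_diff[OF q[OF that] wv(1)]]] Hnorm_0[OF L2[OF Hs_diff[OF q[OF that] wv(2)]]])
    finally show ?thesis .
  qed
  then have "\<forall>\<^sub>F h in at 0 within {- t..}. D \<le> 2 * (Hnorm l 0 (\<lambda>s. q h s - w s))\<^sup>2 + 2 * (Hnorm l 0 (\<lambda>s. q h s - v s))\<^sup>2"
    by (auto simp: eventually_at_filter)
  moreover have "((\<lambda>h. 2 * (Hnorm l 0 (\<lambda>s. q h s - w s))\<^sup>2 + 2 * (Hnorm l 0 (\<lambda>s. q h s - v s))\<^sup>2)
      \<longlongrightarrow> 2 * 0\<^sup>2 + 2 * 0\<^sup>2) (at 0 within {- t..})"
    using w v unfolding q_def has_time_deriv_def by (intro tendsto_intros) auto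
  moreover have "at 0 within {- t..} \<noteq> bot"
  proof -
    have "at_right 0 \<le> at 0 within {- t..}"
      using t by (intro at_le) auto
    then show ?thesis
      using trivial_limit_at_right_real[of "0 :: real"] by (auto simp: bot_unique)
  qed
  ultimately have "D \<le> 2 * 0\<^sup>2 + 2 * 0\<^sup>2"
    by (intro tendsto_lowerbound) auto
  moreover have "0 \<le> D" by (simp add: D_def)
  ultimately have "D = 0" by simp
  then have "AE s in lebesgue_on {0<..<l}. (norm (w s - v s))\<^sup>2 = 0"
    unfolding D_def using int[OF wv] by (subst (asm) integral_nonneg_eq_0_iff_AE) auto
  then show ?thesis by simp
qed

text \<open>
  The equation is stated with the time derivative in \<open>L\<^sup>2\<close>, whereas its continuity and its derivative
  in \<open>s\<close> come from the derivative in the norm of \<open>H\<^sup>m\<close>; the two are identified here.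
\<close>

lemma ptval_tderiv:
  assumes v: "has_time_deriv l m u v t" and t: "t \<ge> 0"
  shows "ptval l (tderiv l u t) = ptval l v"
proof -
  have v0: "has_time_deriv l 0 u v t"
    by (rule has_time_deriv_mono[OF v]) simp
  then have "has_time_deriv l 0 u (tderiv l u t) t"
    unfolding tderiv_def by (rule someI[of "\<lambda>w. has_time_deriv l 0 u w t"])
  then show ?thesis
    by (intro ptval_cong_AE has_time_deriv_unique[OF _ v0 t])
qed

lemma time_cont_uniform_limit:
  assumes l: "l > 0" and u: "time_cont l m u" and k: "k < m" and t: "t \<ge> 0"
  shows "uniform_limit {0..l} (\<lambda>r. dval l k (u r)) (dval l k (u t)) (at t within {0..})"
proof -
  have H: "u r \<in> Hs l m" if "r \<ge> 0" for r using u that by (simp add: time_cont_def)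
  have ev: "\<forall>\<^sub>F r in at t within {0..}. r \<ge> 0"
    by (simp add: eventually_at_filter)
  have "uniform_limit {0..l} (\<lambda>r s. dval l k (\<lambda>s. u r s - u t s) s) (\<lambda>_. 0) (at t within {0..})"
  proof (rule uniform_limit_dval[OF l k])
    show "\<forall>\<^sub>F r in at t within {0..}. (\<lambda>s. u r s - u t s) \<in> Hs l m"
      using ev by eventually_elim (intro Hs_diff H t)
    show "((\<lambda>r. Hnorm l m (\<lambda>s. u r s - u t s)) \<longlongrightarrow> 0) (at t within {0..})"
      using u t by (simp add: time_cont_def)
  qed
  then have D: "\<forall>\<^sub>F r in at t within {0..}. \<forall>s\<in>{0..l}. dist (dval l k (\<lambda>s. u r s - u t s) s) 0 < e" if "e > 0" for e
    using that by (rule uniform_limitD)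
  have "\<forall>\<^sub>F r in at t within {0..}. \<forall>s\<in>{0..l}. dist (dval l k (u r) s) (dval l k (u t) s) < e" if "e > 0" for e
    using D[OF that] ev by eventually_elim (simp add: dval_diff[OF H H[OF t] l k] dist_norm)
  then show ?thesis by (intro uniform_limitI)
qed

lemma has_time_deriv_uniform_limit:
  assumes l: "l > 0" and u: "has_time_deriv l m u w t" and k: "k < m" and t: "t \<ge> 0"
  shows "uniform_limit {0..l} (\<lambda>r s. (dval l k (u r) s - dval l k (u t) s) /\<^sub>R (r - t)) (dval l k w) (at t within {0..})"
proof -
  have H: "u r \<in> Hs l m" if "r \<ge> 0" for r using u that by (simp add: has_time_deriv_def)
  have w: "w \<in> Hs l m" using u by (simp add: has_time_deriv_def)
  have ev: "\<forall>\<^sub>F r in at t within {0..}. r \<ge> 0"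
    by (simp add: eventually_at_filter)
  have Hq: "(\<lambda>s. (u r s - u t s) /\<^sub>R (r - t)) \<in> Hs l m" if "r \<ge> 0" for r
    by (intro Hs_scaleR Hs_diff H that t)
  have "uniform_limit {0..l} (\<lambda>r s. dval l k (\<lambda>s. (u r s - u t s) /\<^sub>R (r - t) - w s) s) (\<lambda>_. 0) (at t within {0..})"
  proof (rule uniform_limit_dval[OF l k])
    show "\<forall>\<^sub>F r in at t within {0..}. (\<lambda>s. (u r s - u t s) /\<^sub>R (r - t) - w s) \<in> Hs l m"
      using ev by eventually_elim (intro Hs_diff Hq w)
    have "((\<lambda>h. Hnorm l m (\<lambda>s. (u (t + h) s - u t s) /\<^sub>R h - w s)) \<longlongrightarrow> 0) (at 0 within {- t..})"
      using u by (simp add: has_time_deriv_def)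
    moreover have "filterlim (\<lambda>r. r - t) (at 0 within {- t..}) (at t within {0..})"
      by (auto simp: filterlim_at eventually_at_filter intro!: tendsto_eq_intros)
    ultimately have "((\<lambda>r. Hnorm l m (\<lambda>s. (u (t + (r - t)) s - u t s) /\<^sub>R (r - t) - w s)) \<longlongrightarrow> 0) (at t within {0..})"
      by (rule filterlim_compose)
    then show "((\<lambda>r. Hnorm l m (\<lambda>s. (u r s - u t s) /\<^sub>R (r - t) - w s)) \<longlongrightarrow> 0) (at t within {0..})"
      by simp
  qed
  then have D: "\<forall>\<^sub>F r in at t within {0..}. \<forall>s\<in>{0..l}. dist (dval l k (\<lambda>s. (u r s - u t s) /\<^sub>R (r - t) - w s) s) 0 < e" if "e > 0" for e
    using that by (rule uniform_limitD)
  have eq: "dval l k (\<lambda>s. (u r s - u t s) /\<^sub>R (r - t) - w s) s =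
      (dval l k (u r) s - dval l k (u t) s) /\<^sub>R (r - t) - dval l k w s" if "r \<ge> 0" "s \<in> {0..l}" for r s
    using that by (simp add: dval_diff[OF Hq w l k] dval_scaleR[OF Hs_diff[OF H H[OF t]] l k] dval_diff[OF H H[OF t] l k])
  show ?thesis
  proof (rule uniform_limitI)
    fix e :: real assume "e > 0"
    from D[OF this] ev show "\<forall>\<^sub>F r in at t within {0..}. \<forall>s\<in>{0..l}.
        dist ((dval l k (u r) s - dval l k (u t) s) /\<^sub>R (r - t)) (dval l k w s) < e"
      by eventually_elim (simp add: eq dist_norm)
  qed
qed

text \<open>
  At a fixed point \<open>s\<close> this is the mean value theorem, applied to the inner product with each vector.
\<close>

lemma constant_time_deriv:
  fixes x v :: "real \<Rightarrow> real \<Rightarrow> 'a::euclidean_space"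
  assumes l: "l > 0" and x: "time_cont l m x" and v: "\<And>t. t > 0 \<Longrightarrow> has_time_deriv l m' x (v t) t"
    and k: "k < m" "k < m'" and s: "s \<in> {0..l}" and w: "\<And>t. t > 0 \<Longrightarrow> dval l k (v t) s = w"
    and t: "t > 0"
  shows "dval l k (x t) s = dval l k (x 0) s + t *\<^sub>R w"
proof -
  have "(dval l k (x t) s - t *\<^sub>R w) \<bullet> b = dval l k (x 0) s \<bullet> b" for b
  proof -
    define g where "g r = (dval l k (x r) s - r *\<^sub>R w) \<bullet> b" for r
    have "((\<lambda>r. dval l k (x r) s) \<longlongrightarrow> dval l k (x r) s) (at r within {0..})" if "r \<ge> 0" for r
      using tendsto_uniform_limitI[OF time_cont_uniform_limit[OF l x k(1) that] s] .
    then have "continuous_on {0..} g"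
      unfolding g_def by (auto simp: continuous_on_def intro!: tendsto_intros)
    then have "continuous_on {0..t} g"
      by (rule continuous_on_subset) auto
    moreover have "(g has_real_derivative 0) (at r)" if r: "0 < r" for r
    proof -
      have "((\<lambda>y. (dval l k (x y) s - dval l k (x r) s) /\<^sub>R (y - r)) \<longlongrightarrow> w) (at r within {0..})"
        using tendsto_uniform_limitI[OF has_time_deriv_uniform_limit[OF l v[OF r] k(2) less_imp_le[OF r]] s]
        by (simp add: w[OF r])
      then have "((\<lambda>y. ((dval l k (x y) s - dval l k (x r) s) /\<^sub>R (y - r) - w) \<bullet> b) \<longlongrightarrow> (w - w) \<bullet> b) (at r within {0..})"
        by (intro tendsto_intros)
      moreover have "\<forall>\<^sub>F y in at r within {0..}.
          ((dval l k (x y) s - dval l k (x r) s) /\<^sub>R (y - r) - w) \<bullet> b = (g y - g r) / (y - r)"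
      proof -
        have "((dval l k (x y) s - dval l k (x r) s) /\<^sub>R (y - r) - w) \<bullet> b = (g y - g r) / (y - r)" if "y \<noteq> r" for y
        proof -
          have "g y - g r = (dval l k (x y) s - dval l k (x r) s) \<bullet> b - (y - r) * (w \<bullet> b)"
            by (simp add: g_def inner_diff_left algebra_simps)
          moreover have "((dval l k (x y) s - dval l k (x r) s) /\<^sub>R (y - r) - w) \<bullet> b =
              inverse (y - r) * ((dval l k (x y) s - dval l k (x r) s) \<bullet> b) - w \<bullet> b"
            by (simp only: inner_diff_left[of "_ /\<^sub>R _" w b] inner_scaleR_left)
          ultimately show ?thesis
            using that by (simp add: field_simps)
        qed
        then show ?thesis by (auto simp: eventually_at_filter)
      qed
      ultimately have "((\<lambda>y. (g y - g r) / (y - r)) \<longlongrightarrow> (w - w) \<bullet> b) (at r within {0..})"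
        by (rule Lim_transform_eventually)
      then have "(g has_real_derivative 0) (at r within {0..})"
        by (simp add: has_field_derivative_iff)
      then show ?thesis
        using r at_within_interior[of r "{0..}"] by simp
    qed
    ultimately have "g t = g 0"
      using t by (intro DERIV_isconst2[of 0 t g t]) auto
    then show ?thesis by (simp add: g_def)
  qed
  then have "dval l k (x t) s - t *\<^sub>R w = dval l k (x 0) s"
    by (metis vector_eq_rdot)
  then show ?thesis by (simp add: algebra_simps)
qed

section \<open>The Wirtinger inequality\<close>

text \<open>
  With \<open>w(s) = \<alpha> tan (\<alpha> (s - l / 2))\<close>, a solution of the Riccati equation \<open>w' = \<alpha>\<^sup>2 + w\<^sup>2\<close>, the integrand
  \<open>|u'|\<^sup>2 - \<alpha>\<^sup>2 |u|\<^sup>2\<close> is the square \<open>|u' + w u|\<^sup>2\<close> minus the derivative of \<open>w |u|\<^sup>2\<close>, which integrates to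
  \<open>0\<close>. For \<open>\<alpha> < \<pi> / l\<close> the argument of the tangent stays inside \<open>(-\<pi>/2, \<pi>/2)\<close> on the whole closed
  interval, so \<open>w\<close> has no singularities.
\<close>

lemma wirtinger_subcritical:
  fixes u u' :: "real \<Rightarrow> 'a::euclidean_space"
  assumes l: "l > 0" and \<alpha>: "0 \<le> \<alpha>" "\<alpha> < pi / l"
    and der: "\<And>s. s \<in> {0..l} \<Longrightarrow> (u has_vector_derivative u' s) (at s within {0..l})"
    and cont: "continuous_on {0..l} u'" and bc: "u 0 = 0" "u l = 0"
  shows "\<alpha>\<^sup>2 * integral {0..l} (\<lambda>s. (norm (u s))\<^sup>2) \<le> integral {0..l} (\<lambda>s. (norm (u' s))\<^sup>2)"
proof -
  have contu: "continuous_on {0..l} u"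
    using has_vector_derivative_continuous[OF der] by (simp add: continuous_on_eq_continuous_within)
  have cu: "continuous_on {0..l} (\<lambda>s. (norm (u s))\<^sup>2)" "continuous_on {0..l} (\<lambda>s. (norm (u' s))\<^sup>2)"
    by (intro continuous_intros cont contu)+
  define w where "w s = \<alpha> * tan (\<alpha> * (s - l / 2))" for s
  define H' where "H' s = w s * (2 * (u s \<bullet> u' s)) + (\<alpha>\<^sup>2 + (w s)\<^sup>2) * (u s \<bullet> u s)" for s
  have w: "(w has_real_derivative \<alpha>\<^sup>2 + (w s)\<^sup>2) (at s within {0..l})" if s: "s \<in> {0..l}" for s
  proof -
    have "\<bar>s - l / 2\<bar> \<le> l / 2"
      unfolding abs_le_iff using s by auto
    then have "\<bar>\<alpha> * (s - l / 2)\<bar> \<le> \<alpha> * (l / 2)"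
      unfolding abs_mult using \<alpha> by (simp only: abs_of_nonneg mult_left_mono)
    also have "\<dots> < pi / 2"
      using \<alpha> l by (simp add: field_simps)
    finally have "cos (\<alpha> * (s - l / 2)) > 0"
      by (intro cos_gt_zero_pi) auto
    then have "(w has_real_derivative \<alpha> * (inverse ((cos (\<alpha> * (s - l / 2)))\<^sup>2) * \<alpha>)) (at s within {0..l})"
      unfolding w_def by (auto intro!: derivative_eq_intros)
    moreover have "inverse ((cos (\<alpha> * (s - l / 2)))\<^sup>2) = 1 + (tan (\<alpha> * (s - l / 2)))\<^sup>2"
      using \<open>cos (\<alpha> * (s - l / 2)) > 0\<close> tan_sec[of "\<alpha> * (s - l / 2)"] by (simp add: power_inverse)
    ultimately show ?thesis
      by (simp add: w_def power2_eq_square algebra_simps)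
  qed
  have "((\<lambda>s. w s * (u s \<bullet> u s)) has_vector_derivative H' s) (at s within {0..l})" if s: "s \<in> {0..l}" for s
  proof -
    have "((\<lambda>s. u s \<bullet> u s) has_vector_derivative u s \<bullet> u' s + u' s \<bullet> u s) (at s within {0..l})"
      by (rule bounded_bilinear.has_vector_derivative[OF bounded_bilinear_inner der[OF s] der[OF s]])
    from has_vector_derivative_scaleR[OF w[OF s] this] show ?thesis
      by (simp add: H'_def inner_commute algebra_simps)
  qed
  then have H: "(H' has_integral 0) {0..l}"
    using fundamental_theorem_of_calculus[of 0 l "\<lambda>s. w s * (u s \<bullet> u s)" H'] l bc by simp
  have "0 \<le> integral {0..l} (\<lambda>s. (norm (u' s))\<^sup>2 - \<alpha>\<^sup>2 * (norm (u s))\<^sup>2 + H' s)"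
  proof (rule integral_nonneg)
    show "(\<lambda>s. (norm (u' s))\<^sup>2 - \<alpha>\<^sup>2 * (norm (u s))\<^sup>2 + H' s) integrable_on {0..l}"
      by (intro integrable_add[OF _ has_integral_integrable[OF H]] integrable_continuous_real
          continuous_intros contu cont)
    fix s
    have "(norm (u' s))\<^sup>2 - \<alpha>\<^sup>2 * (norm (u s))\<^sup>2 + H' s = (norm (u' s + w s *\<^sub>R u s))\<^sup>2"
      unfolding H'_def power2_norm_eq_inner
      by (simp add: inner_add_left inner_add_right inner_commute power2_eq_square algebra_simps)
    then show "0 \<le> (norm (u' s))\<^sup>2 - \<alpha>\<^sup>2 * (norm (u s))\<^sup>2 + H' s" by simp
  qed
  also have "\<dots> = integral {0..l} (\<lambda>s. (norm (u' s))\<^sup>2) - \<alpha>\<^sup>2 * integral {0..l} (\<lambda>s. (norm (u s))\<^sup>2)"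
    using has_integral_add[OF has_integral_diff[OF integrable_integral[OF integrable_continuous_real[OF cu(2)]]
          has_integral_mult_right[OF integrable_integral[OF integrable_continuous_real[OF cu(1)]], of "\<alpha>\<^sup>2"]] H]
    by (simp add: integral_unique)
  finally show ?thesis by simp
qed

text \<open>
  The limit \<open>\<alpha> \<rightarrow> \<pi> / l\<close> of the subcritical inequality, with \<open>\<alpha>\<^sup>2 = z (\<pi> / l)\<^sup>2\<close> and \<open>z < 1\<close>.
\<close>

lemma wirtinger:
  fixes u u' :: "real \<Rightarrow> 'a::euclidean_space"
  assumes l: "l > 0"
    and der: "\<And>s. s \<in> {0..l} \<Longrightarrow> (u has_vector_derivative u' s) (at s within {0..l})"
    and cont: "continuous_on {0..l} u'" and bc: "u 0 = 0" "u l = 0"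
  shows "(pi / l)\<^sup>2 * integral {0..l} (\<lambda>s. (norm (u s))\<^sup>2) \<le> integral {0..l} (\<lambda>s. (norm (u' s))\<^sup>2)"
proof (rule field_le_mult_one_interval)
  fix z :: real assume z: "0 < z" "z < 1"
  have "sqrt z * (pi / l) < 1 * (pi / l)"
    using z l by (intro mult_strict_right_mono) auto
  then have "(sqrt z * (pi / l))\<^sup>2 * integral {0..l} (\<lambda>s. (norm (u s))\<^sup>2) \<le> integral {0..l} (\<lambda>s. (norm (u' s))\<^sup>2)"
    using z l by (intro wirtinger_subcritical[OF l _ _ der cont bc]) auto
  then show "z * ((pi / l)\<^sup>2 * integral {0..l} (\<lambda>s. (norm (u s))\<^sup>2)) \<le> integral {0..l} (\<lambda>s. (norm (u' s))\<^sup>2)"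
    using z by (simp add: power_mult_distrib power_divide mult.assoc)
qed

section \<open>Conservation of the bending energy\<close>

text \<open>
  The difference of squares factors into \<open>(x\<^sub>s\<^sub>s - y\<^sub>s\<^sub>s) \<bullet> (x\<^sub>s\<^sub>s + y\<^sub>s\<^sub>s)\<close>. Integrating the first factor to
  \<open>x\<^sub>s - y\<^sub>s\<close>, which vanishes at the ends, moves a derivative off the difference of the two curves.
  For two nearby times the difference quotient of what remains converges uniformly if the curve is
  differentiable in time in the norm of \<open>H\<^sup>2\<close>.
\<close>

lemma energy_difference:
  fixes x y :: "real \<Rightarrow> 'a::euclidean_space"
  assumes l: "l > 0" and x: "x \<in> Hs l 4" and y: "y \<in> Hs l 4"
    and bc: "dval l 1 x 0 = dval l 1 y 0" "dval l 1 x l = dval l 1 y l"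
  shows "integral {0..l} (\<lambda>s. (norm (dval l 2 x s))\<^sup>2) - integral {0..l} (\<lambda>s. (norm (dval l 2 y s))\<^sup>2) =
    - integral {0..l} (\<lambda>s. (dval l 1 x s - dval l 1 y s) \<bullet> (dval l 3 x s + dval l 3 y s))"
proof -
  let ?D = "\<lambda>s. dval l 1 x s - dval l 1 y s" and ?D' = "\<lambda>s. dval l 2 x s - dval l 2 y s"
  let ?S = "\<lambda>s. dval l 2 x s + dval l 2 y s" and ?S' = "\<lambda>s. dval l 3 x s + dval l 3 y s"
  have d: "(dval l 1 z has_vector_derivative dval l 2 z s) (at s within {0..l})"
    "(dval l 2 z has_vector_derivative dval l 3 z s) (at s within {0..l})"
    if "z \<in> Hs l 4" "s \<in> {0..l}" for z :: "real \<Rightarrow> 'a" and s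
    using dval_has_vector_derivative[OF l that(1) _ that(2), of 1]
      dval_has_vector_derivative[OF l that(1) _ that(2), of 2] by (simp_all add: numeral_eq_Suc)
  have c: "continuous_on {0..l} (dval l k z)" if "z \<in> Hs l 4" "k < 4" for z :: "real \<Rightarrow> 'a" and k
    by (rule dval_continuous[OF l that])
  have "((\<lambda>s. ?D s \<bullet> ?S' s + ?D' s \<bullet> ?S s) has_integral ?D l \<bullet> ?S l - ?D 0 \<bullet> ?S 0) {0..l}"
    using l by (intro fundamental_theorem_of_calculus
        bounded_bilinear.has_vector_derivative[OF bounded_bilinear_inner]
        has_vector_derivative_diff has_vector_derivative_add d x y) auto
  then have "integral {0..l} (\<lambda>s. ?D s \<bullet> ?S' s + ?D' s \<bullet> ?S s) = 0"
    using bc by (simp add: integral_unique)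
  moreover have "integral {0..l} (\<lambda>s. ?D s \<bullet> ?S' s + ?D' s \<bullet> ?S s) =
      integral {0..l} (\<lambda>s. ?D s \<bullet> ?S' s) + integral {0..l} (\<lambda>s. ?D' s \<bullet> ?S s)"
    by (intro Henstock_Kurzweil_Integration.integral_add integrable_continuous_real continuous_intros c x y) auto
  moreover have "integral {0..l} (\<lambda>s. ?D' s \<bullet> ?S s) =
      integral {0..l} (\<lambda>s. (norm (dval l 2 x s))\<^sup>2 - (norm (dval l 2 y s))\<^sup>2)"
    by (rule arg_cong[where f = "integral _"])
       (simp add: power2_norm_eq_inner inner_diff_left inner_diff_right inner_add_left inner_add_right
          inner_commute fun_eq_iff)
  moreover have "\<dots> = integral {0..l} (\<lambda>s. (norm (dval l 2 x s))\<^sup>2) - integral {0..l} (\<lambda>s. (norm (dval l 2 y s))\<^sup>2)"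
    by (intro Henstock_Kurzweil_Integration.integral_diff integrable_continuous_real continuous_intros c x y) auto
  ultimately show ?thesis by linarith
qed

lemma integral_tendsto_0:
  fixes f :: "'b \<Rightarrow> real \<Rightarrow> real"
  assumes l: "l > 0" and f: "uniform_limit {0..l} f (\<lambda>_. 0) F"
    and c: "\<forall>\<^sub>F r in F. continuous_on {0..l} (f r)"
  shows "((\<lambda>r. integral {0..l} (f r)) \<longlongrightarrow> 0) F"
proof (rule tendstoI)
  fix e :: real assume "e > 0"
  then have "\<forall>\<^sub>F r in F. \<forall>s\<in>{0..l}. dist (f r s) 0 < e / (2 * l)"
    using l by (intro uniform_limitD[OF f]) auto
  then show "\<forall>\<^sub>F r in F. dist (integral {0..l} (f r)) 0 < e"
    using c
  proof eventually_elim
    case (elim r)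
    have "norm (integral {0..l} (f r)) \<le> e / (2 * l) * (l - 0)"
      using elim l by (intro integral_bound) (auto simp: less_imp_le)
    also have "\<dots> < e" using l \<open>e > 0\<close> by simp
    finally show ?case by simp
  qed
qed

lemma bounded_bilinear_cross3: "bounded_bilinear cross3"
  using bilinear_cross by (simp add: bilinear_conv_bounded_bilinear)

text \<open>
  For positive time, dividing \<open>energy_difference\<close> by the time step gives in the limit
  \<open>- 2 \<integral> V \<bullet> x\<^sub>s\<^sub>s\<^sub>s\<close> with \<open>V = x\<^sub>s\<^sub>t = x\<^sub>s \<times> x\<^sub>s\<^sub>s\<^sub>s\<close>, and the integrand is \<open>0\<close>. The equation is given for
  positive time only; at time \<open>0\<close> the same formula shows that the energy is continuous.
\<close>

lemma energy_conserved:
  fixes x v :: "real \<Rightarrow> real \<Rightarrow> real^3"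
  assumes l: "l > 0" and x: "time_cont l 4 x"
    and v: "\<And>t. t > 0 \<Longrightarrow> has_time_deriv l 2 x (v t) t"
    and bc: "\<And>t. t \<ge> 0 \<Longrightarrow> dval l 1 (x t) 0 = p" "\<And>t. t \<ge> 0 \<Longrightarrow> dval l 1 (x t) l = q"
    and eqn: "\<And>t s. t > 0 \<Longrightarrow> s \<in> {0<..<l} \<Longrightarrow>
       dval l 0 (v t) s = cross3 (dval l 1 (x t) s) (dval l 2 (x t) s)"
    and t: "t \<ge> 0"
  shows "integral {0..l} (\<lambda>s. (norm (dval l 2 (x t) s))\<^sup>2) = integral {0..l} (\<lambda>s. (norm (dval l 2 (x 0) s))\<^sup>2)"
proof -
  define E where "E t = integral {0..l} (\<lambda>s. (norm (dval l 2 (x t) s))\<^sup>2)" for t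
  have H: "x t \<in> Hs l 4" if "t \<ge> 0" for t using x that by (simp add: time_cont_def)
  have c: "continuous_on {0..l} (dval l k (x t))" if "t \<ge> 0" "k < 4" for t k
    by (rule dval_continuous[OF l H that(2)]) fact
  have ev: "\<forall>\<^sub>F r in at t within {0..}. r \<ge> 0" for t :: real
    by (simp add: eventually_at_filter)
  have lim3: "uniform_limit {0..l} (\<lambda>r s. dval l 3 (x r) s + dval l 3 (x t) s)
      (\<lambda>s. dval l 3 (x t) s + dval l 3 (x t) s) (at t within {0..})" if "t \<ge> 0" for t
    by (intro uniform_limit_intros time_cont_uniform_limit[OF l x _ that]) simp
  have b3: "bounded ((\<lambda>s. dval l 3 (x t) s + dval l 3 (x t) s) ` {0..l})" if "t \<ge> 0" for t
    by (intro compact_imp_bounded compact_continuous_image continuous_intros c that compact_Icc) simp_all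
  have diff: "E r - E t = - integral {0..l} (\<lambda>s. (dval l 1 (x r) s - dval l 1 (x t) s) \<bullet> (dval l 3 (x r) s + dval l 3 (x t) s))"
    if "r \<ge> 0" "t \<ge> 0" for r t
    unfolding E_def using that by (intro energy_difference l H) (simp_all only: bc)
  have der: "(E has_real_derivative 0) (at t within {0..})" if t: "t > 0" for t
  proof -
    let ?T = "dval l 1 (x t)" and ?B = "dval l 2 (x t)" and ?C = "dval l 3 (x t)" and ?V = "dval l 1 (v t)"
    have vH: "v t \<in> Hs l 2" using v[OF t] by (simp add: has_time_deriv_def)
    have cV: "continuous_on {0..l} ?V" by (rule dval_continuous[OF l vH]) simp
    \<comment> \<open>The equation holds on the open interval only, so it is differentiated there.\<close>
    have VC: "?V s = cross3 (?T s) (?C s)" if s: "s \<in> {0<..<l}" for s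
    proof -
      have at: "at s within {0..l} = at s" using s by (intro at_within_Icc_at) auto
      have "(dval l 0 (v t) has_vector_derivative ?V s) (at s)"
        using dval_has_vector_derivative[OF l vH, of 0 s] s at by simp
      moreover have "(dval l 0 (v t) has_vector_derivative cross3 (?T s) (?C s) + cross3 (?B s) (?B s)) (at s)"
      proof -
        have d: "(?T has_vector_derivative ?B s) (at s)" "(?B has_vector_derivative ?C s) (at s)"
          using dval_has_vector_derivative[OF l H, of t 1 s] dval_has_vector_derivative[OF l H, of t 2 s] s at t
          by (simp_all add: numeral_eq_Suc)
        have "((\<lambda>s. cross3 (?T s) (?B s)) has_vector_derivative cross3 (?T s) (?C s) + cross3 (?B s) (?B s)) (at s)"
          by (rule bounded_bilinear.has_vector_derivative[OF bounded_bilinear_cross3 d])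
        then show ?thesis
          by (rule has_vector_derivative_transform_within_open[of _ _ _ "{0<..<l}"])
             (use s t in \<open>auto simp: eqn\<close>)
      qed
      ultimately show ?thesis
        using vector_derivative_unique_at by fastforce
    qed
    have zero: "?V s \<bullet> (?C s + ?C s) = 0" if s: "s \<in> {0..l}" for s
    proof (rule continuous_AE_eq_imp_eq[OF l _ _ _ s])
      show "continuous_on {0..l} (\<lambda>s. ?V s \<bullet> (?C s + ?C s))"
        using t by (intro continuous_intros cV c) auto
      show "AE s in lebesgue_on {0<..<l}. ?V s \<bullet> (?C s + ?C s) = 0"
      proof (rule AE_I2)
        fix s assume "s \<in> space (lebesgue_on {0<..<l})"
        then have "?V s = cross3 (?T s) (?C s)" by (intro VC) simp
        then show "?V s \<bullet> (?C s + ?C s) = 0"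
          by (simp only: inner_add_right dot_cross_self add_0)
      qed
    qed simp
    let ?Q = "\<lambda>r s. ((dval l 1 (x r) s - ?T s) /\<^sub>R (r - t)) \<bullet> (dval l 3 (x r) s + ?C s)"
    have "uniform_limit {0..l} ?Q (\<lambda>s. ?V s \<bullet> (?C s + ?C s)) (at t within {0..})"
      using t by (intro bounded_bilinear.bounded_uniform_limit[OF bounded_bilinear_inner]
          has_time_deriv_uniform_limit[OF l v[OF t]] lim3 b3 compact_imp_bounded compact_continuous_image cV) auto
    then have "uniform_limit {0..l} ?Q (\<lambda>_. 0) (at t within {0..})"
      by (rule uniform_limit_cong'[THEN iffD1, rotated 2]) (rule refl, erule zero)
    moreover have "\<forall>\<^sub>F r in at t within {0..}. continuous_on {0..l} (?Q r)"
      using ev by eventually_elim (use t in \<open>auto intro!: continuous_intros c\<close>)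
    ultimately have "((\<lambda>r. integral {0..l} (?Q r)) \<longlongrightarrow> 0) (at t within {0..})"
      by (rule integral_tendsto_0[OF l])
    from tendsto_minus[OF this]
    have "((\<lambda>r. - integral {0..l} (?Q r)) \<longlongrightarrow> 0) (at t within {0..})"
      by (simp only: minus_zero)
    moreover have "\<forall>\<^sub>F r in at t within {0..}. - integral {0..l} (?Q r) = (E r - E t) / (r - t)"
      using ev by eventually_elim (use t in \<open>simp add: diff divide_inverse mult.commute\<close>)
    ultimately have "((\<lambda>r. (E r - E t) / (r - t)) \<longlongrightarrow> 0) (at t within {0..})"
      by (rule Lim_transform_eventually)
    then show ?thesis by (simp add: has_field_derivative_iff)
  qed
  have cont0: "(E \<longlongrightarrow> E 0) (at 0 within {0..})"
  proof -
    let ?Q = "\<lambda>r s. (dval l 1 (x r) s - dval l 1 (x 0) s) \<bullet> (dval l 3 (x r) s + dval l 3 (x 0) s)"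
    have "uniform_limit {0..l} ?Q
       (\<lambda>s. (dval l 1 (x 0) s - dval l 1 (x 0) s) \<bullet> (dval l 3 (x 0) s + dval l 3 (x 0) s)) (at 0 within {0..})"
      by (intro bounded_bilinear.bounded_uniform_limit[OF bounded_bilinear_inner] lim3 b3
          uniform_limit_minus uniform_limit_const time_cont_uniform_limit[OF l x]) (auto simp: image_constant_conv)
    then have "uniform_limit {0..l} ?Q (\<lambda>_. 0) (at 0 within {0..})" by simp
    moreover have "\<forall>\<^sub>F r in at 0 within {0..}. continuous_on {0..l} (?Q r)"
      using ev by eventually_elim (auto intro!: continuous_intros c)
    ultimately have "((\<lambda>r. integral {0..l} (?Q r)) \<longlongrightarrow> 0) (at 0 within {0..})"
      by (rule integral_tendsto_0[OF l])
    then have "((\<lambda>r. E 0 - integral {0..l} (?Q r)) \<longlongrightarrow> E 0 - 0) (at 0 within {0..})"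
      by (intro tendsto_intros)
    moreover have "\<forall>\<^sub>F r in at 0 within {0..}. E 0 - integral {0..l} (?Q r) = E r"
      using ev by eventually_elim (use diff[of _ 0] in \<open>simp add: algebra_simps\<close>)
    ultimately show ?thesis
      by (simp add: tendsto_cong)
  qed
  have "continuous_on {0..} E"
    unfolding continuous_on_def
  proof
    fix r :: real assume "r \<in> {0..}"
    then show "(E \<longlongrightarrow> E r) (at r within {0..})"
      using cont0 DERIV_continuous[OF der, of r] by (cases "r = 0") (auto simp: continuous_within)
  qed
  then have "continuous_on {0..t} E"
    by (rule continuous_on_subset) auto
  moreover have "(E has_real_derivative 0) (at r)" if "0 < r" for r
    using der[OF that] that at_within_interior[of r "{0..}"] by simp
  ultimately have "E t = E 0"
    using t DERIV_isconst2[of 0 t E t] by (cases "t = 0") auto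
  then show ?thesis by (simp add: E_def)
qed

section \<open>The arc and the energy of its perturbations\<close>

text \<open>
  The \<open>k\<close>-th derivative of the arc: each differentiation in \<open>s\<close> divides by \<open>R\<close> and turns by a right
  angle.
\<close>

definition arc_deriv :: "real \<Rightarrow> real \<Rightarrow> nat \<Rightarrow> real \<Rightarrow> real^3" where
  "arc_deriv R t k s = (R * (1 / R) ^ k * cos (s / R + k * (pi / 2))) *\<^sub>R axis 1 1 +
     (R * (1 / R) ^ k * sin (s / R + k * (pi / 2))) *\<^sub>R axis 2 1 + (if k = 0 then t / R else 0) *\<^sub>R axis 3 1"

lemma axis_sum_eq_vector:
  "a *\<^sub>R axis 1 1 + b *\<^sub>R axis 2 1 + c *\<^sub>R axis 3 1 = (vector [a, b, c] :: real^3)"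
  by (simp add: vec_eq_iff forall_3 axis_def)

lemma arc_deriv_has_vector_derivative:
  assumes "R > 0"
  shows "(arc_deriv R t k has_vector_derivative arc_deriv R t (Suc k) s) (at s)"
proof -
  let ?a = "s / R + k * (pi / 2)"
  have shift: "s / R + Suc k * (pi / 2) = ?a + pi / 2"
    by (simp add: field_simps)
  have trig: "cos (?a + pi / 2) = - sin ?a" "sin (?a + pi / 2) = cos ?a"
    by (simp_all add: cos_add sin_add)
  have c: "((\<lambda>s. R * (1 / R) ^ k * cos (s / R + k * (pi / 2))) has_real_derivative
      R * (1 / R) ^ Suc k * (- sin ?a)) (at s)"
    by (auto intro!: derivative_eq_intros)
  have s: "((\<lambda>s. R * (1 / R) ^ k * sin (s / R + k * (pi / 2))) has_real_derivative
      R * (1 / R) ^ Suc k * cos ?a) (at s)"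
    by (auto intro!: derivative_eq_intros)
  have "((\<lambda>s. (R * (1 / R) ^ k * cos (s / R + k * (pi / 2))) *\<^sub>R axis 1 1 +
     (R * (1 / R) ^ k * sin (s / R + k * (pi / 2))) *\<^sub>R axis 2 1 + (if k = 0 then t / R else 0) *\<^sub>R axis 3 1)
     has_vector_derivative (R * (1 / R) ^ Suc k * (- sin ?a)) *\<^sub>R axis 1 1 +
      (R * (1 / R) ^ Suc k * cos ?a) *\<^sub>R axis 2 1 + (0 :: real^3)) (at s)"
    using has_vector_derivative_add[OF has_vector_derivative_add[OF
          has_vector_derivative_scaleR[OF c has_vector_derivative_const[of "axis 1 1"]]
          has_vector_derivative_scaleR[OF s has_vector_derivative_const[of "axis 2 1"]]]
        has_vector_derivative_const[of "(if k = 0 then t / R else 0) *\<^sub>R axis 3 1"]]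
    by (simp only: scaleR_zero_right add_0)
  moreover have "arc_deriv R t (Suc k) s = (R * (1 / R) ^ Suc k * (- sin ?a)) *\<^sub>R axis 1 1 +
      (R * (1 / R) ^ Suc k * cos ?a) *\<^sub>R axis 2 1 + (0 :: real^3)"
    unfolding arc_deriv_def shift trig by simp
  moreover have "arc_deriv R t k = (\<lambda>s. (R * (1 / R) ^ k * cos (s / R + k * (pi / 2))) *\<^sub>R axis 1 1 +
     (R * (1 / R) ^ k * sin (s / R + k * (pi / 2))) *\<^sub>R axis 2 1 + (if k = 0 then t / R else 0) *\<^sub>R axis 3 1)"
    by (simp only: fun_eq_iff arc_deriv_def) blast
  ultimately show ?thesis by (simp only:)
qed

lemma arc_deriv_0: "arc_deriv R t 0 = arc_filament R t"
  by (simp add: fun_eq_iff arc_deriv_def arc_filament_def axis_sum_eq_vector)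

lemma arc_deriv_1: "R > 0 \<Longrightarrow> arc_deriv R t 1 s = vector [- sin (s / R), cos (s / R), 0]"
  unfolding arc_deriv_def axis_sum_eq_vector by (simp add: cos_add sin_add)

lemma arc_deriv_2: "R > 0 \<Longrightarrow> arc_deriv R t 2 s = vector [- cos (s / R) / R, - sin (s / R) / R, 0]"
  unfolding arc_deriv_def axis_sum_eq_vector by (simp add: power2_eq_square)

lemma arc_deriv_3: "R > 0 \<Longrightarrow> arc_deriv R t 3 s = - (1 / R\<^sup>2) *\<^sub>R arc_deriv R t 1 s"
proof -
  assume R: "R > 0"
  have "s / R + real 3 * (pi / 2) = (s / R + real 1 * (pi / 2)) + pi" by simp
  then have "cos (s / R + real 3 * (pi / 2)) = - cos (s / R + real 1 * (pi / 2))"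
    "sin (s / R + real 3 * (pi / 2)) = - sin (s / R + real 1 * (pi / 2))"
    by (simp_all only: cos_periodic_pi sin_periodic_pi)
  then show ?thesis
    unfolding arc_deriv_def axis_sum_eq_vector using R
    by (simp add: vec_eq_iff forall_3 power2_eq_square power3_eq_cube)
qed

lemma
  assumes R: "R > 0" and l: "l > 0"
  shows arc_filament_Hs: "arc_filament R t \<in> Hs l m"
    and dval_arc_filament: "s \<in> {0..l} \<Longrightarrow> dval l k (arc_filament R t) s = arc_deriv R t k s"
  using smooth_imp_Hs[where G = "arc_deriv R t", OF l arc_deriv_has_vector_derivative[OF R]]
    dval_smooth[where G = "arc_deriv R t", OF l arc_deriv_has_vector_derivative[OF R]]
  by (simp_all add: arc_deriv_0)

lemma inner_vector_3: "(vector [a, b, c] :: real^3) \<bullet> vector [a', b', c'] = a * a' + b * b' + c * c'"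
  by (simp add: inner_vec_def sum_3)

lemma cross3_arc_deriv:
  "R > 0 \<Longrightarrow> cross3 (arc_deriv R t 1 s) (arc_deriv R t 2 s) = vector [0, 0, 1 / R]"
  unfolding arc_deriv_1 arc_deriv_2 cross3_def
  using sin_cos_squared_add[of "s / R"]
  by (simp add: vec_eq_iff forall_3 power2_eq_square add_divide_distrib[symmetric])

text \<open>
  For unit vectors \<open>|T - \<tau>|\<^sup>2 = 2 - 2 T \<bullet> \<tau>\<close>. With \<open>\<kappa>' = - c \<tau>\<close> the mixed terms of both squares combine to the
  derivative of \<open>(T - \<tau>) \<bullet> \<kappa>\<close>, which integrates to \<open>0\<close> as \<open>T = \<tau>\<close> at the ends.
\<close>

lemma excess_energy:
  fixes T T' \<tau> \<kappa> :: "real \<Rightarrow> 'a::euclidean_space"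
  assumes l: "l > 0"
    and T: "\<And>s. s \<in> {0..l} \<Longrightarrow> (T has_vector_derivative T' s) (at s within {0..l})"
    and \<tau>: "\<And>s. s \<in> {0..l} \<Longrightarrow> (\<tau> has_vector_derivative \<kappa> s) (at s within {0..l})"
    and \<kappa>: "\<And>s. s \<in> {0..l} \<Longrightarrow> (\<kappa> has_vector_derivative - c *\<^sub>R \<tau> s) (at s within {0..l})"
    and cont: "continuous_on {0..l} T'"
    and unit: "\<And>s. s \<in> {0..l} \<Longrightarrow> norm (T s) = 1" "\<And>s. s \<in> {0..l} \<Longrightarrow> norm (\<tau> s) = 1"
      "\<And>s. s \<in> {0..l} \<Longrightarrow> (norm (\<kappa> s))\<^sup>2 = c"
    and bc: "T 0 = \<tau> 0" "T l = \<tau> l"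
  shows "integral {0..l} (\<lambda>s. (norm (T' s - \<kappa> s))\<^sup>2) - c * integral {0..l} (\<lambda>s. (norm (T s - \<tau> s))\<^sup>2)
    = integral {0..l} (\<lambda>s. (norm (T' s))\<^sup>2) - c * l"
proof -
  have ct: "continuous_on {0..l} T" "continuous_on {0..l} \<tau>" "continuous_on {0..l} \<kappa>"
    using has_vector_derivative_continuous[OF T] has_vector_derivative_continuous[OF \<tau>]
      has_vector_derivative_continuous[OF \<kappa>]
    by (simp_all add: continuous_on_eq_continuous_within)
  define F where "F s = (T s - \<tau> s) \<bullet> (- c *\<^sub>R \<tau> s) + (T' s - \<kappa> s) \<bullet> \<kappa> s" for s
  have F: "(F has_integral 0) {0..l}"
  proof -
    have "(F has_integral (T l - \<tau> l) \<bullet> \<kappa> l - (T 0 - \<tau> 0) \<bullet> \<kappa> 0) {0..l}"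
      unfolding F_def using l
      by (intro fundamental_theorem_of_calculus bounded_bilinear.has_vector_derivative[OF bounded_bilinear_inner]
          has_vector_derivative_diff T \<tau> \<kappa>) auto
    then show ?thesis by (simp add: bc)
  qed
  have pt: "(norm (T' s - \<kappa> s))\<^sup>2 - c * (norm (T s - \<tau> s))\<^sup>2 = (norm (T' s))\<^sup>2 - c - 2 * F s" if "s \<in> {0..l}" for s
  proof -
    have u: "T s \<bullet> T s = 1" "\<tau> s \<bullet> \<tau> s = 1" "\<kappa> s \<bullet> \<kappa> s = c"
      using unit[OF that] by (simp_all add: power2_norm_eq_inner[symmetric])
    show ?thesis
      unfolding F_def power2_norm_eq_inner
      using u by (simp add: inner_diff_left inner_diff_right inner_commute algebra_simps)
  qed
  have i: "((\<lambda>s. (norm (T' s))\<^sup>2) has_integral integral {0..l} (\<lambda>s. (norm (T' s))\<^sup>2)) {0..l}"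
    "((\<lambda>s. (norm (T' s - \<kappa> s))\<^sup>2) has_integral integral {0..l} (\<lambda>s. (norm (T' s - \<kappa> s))\<^sup>2)) {0..l}"
    "((\<lambda>s. (norm (T s - \<tau> s))\<^sup>2) has_integral integral {0..l} (\<lambda>s. (norm (T s - \<tau> s))\<^sup>2)) {0..l}"
    by (intro integrable_integral integrable_continuous_real continuous_intros ct cont)+
  have "((\<lambda>s. (norm (T' s))\<^sup>2 - c - 2 * F s) has_integral
     integral {0..l} (\<lambda>s. (norm (T' s))\<^sup>2) - c * l - 2 * 0) {0..l}"
    using has_integral_const_real[of c 0 l] l
    by (intro has_integral_diff has_integral_mult_right i F) (simp add: mult.commute)
  then have "((\<lambda>s. (norm (T' s - \<kappa> s))\<^sup>2 - c * (norm (T s - \<tau> s))\<^sup>2) has_integral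
     integral {0..l} (\<lambda>s. (norm (T' s))\<^sup>2) - c * l) {0..l}"
    by (subst has_integral_cong[OF pt]) simp_all
  moreover have "((\<lambda>s. (norm (T' s - \<kappa> s))\<^sup>2 - c * (norm (T s - \<tau> s))\<^sup>2) has_integral
     integral {0..l} (\<lambda>s. (norm (T' s - \<kappa> s))\<^sup>2) - c * integral {0..l} (\<lambda>s. (norm (T s - \<tau> s))\<^sup>2)) {0..l}"
    by (intro has_integral_diff has_integral_mult_right i)
  ultimately show ?thesis
    by (rule has_integral_unique[symmetric])
qed

lemma arc_perturbation:
  fixes R \<theta> t :: real and z :: "real \<Rightarrow> real^3"
  defines "l \<equiv> \<theta> * R" and "p \<equiv> \<lambda>s. z s - arc_filament R t s"
  assumes R: "R > 0" and \<theta>: "0 < \<theta>" and z: "z \<in> Hs l 4"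
  shows "p \<in> Hs l 4"
    and "\<And>k s. k < 4 \<Longrightarrow> s \<in> {0..l} \<Longrightarrow> dval l k p s = dval l k z s - arc_deriv R t k s"
    and "\<And>k. k < 4 \<Longrightarrow> (L2norm l (wderiv l k p))\<^sup>2 = integral {0..l} (\<lambda>s. (norm (dval l k p s))\<^sup>2)"
proof -
  have l: "l > 0" using R \<theta> by (simp add: l_def)
  note arc = arc_filament_Hs[OF R l, of t 4] dval_arc_filament[OF R l, of _ _ t]
  show p: "p \<in> Hs l 4"
    unfolding p_def by (rule Hs_diff[OF z arc(1)])
  show "dval l k p s = dval l k z s - arc_deriv R t k s" if "k < 4" "s \<in> {0..l}" for k s
    using dval_diff[OF z arc(1) l that] arc(2)[OF that(2)] by (simp add: p_def)
  show "(L2norm l (wderiv l k p))\<^sup>2 = integral {0..l} (\<lambda>s. (norm (dval l k p s))\<^sup>2)" if "k < 4" for k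
    by (rule L2norm_wderiv[OF l p that])
qed

text \<open>
  The excess energy and the Wirtinger inequality for the perturbation \<open>p\<close> of an arc of radius \<open>R\<close> and
  opening angle \<open>\<theta>\<close>; since the length is \<open>\<theta> R\<close>, the factor \<open>l\<^sup>2 / \<pi>\<^sup>2\<close> of the latter divided by \<open>R\<^sup>2\<close> is
  \<open>\<theta>\<^sup>2 / \<pi>\<^sup>2\<close>.
\<close>

lemma arc_perturbation_energy:
  fixes R \<theta> t :: real and z :: "real \<Rightarrow> real^3"
  defines "l \<equiv> \<theta> * R" and "p \<equiv> \<lambda>s. z s - arc_filament R t s"
  assumes R: "R > 0" and \<theta>: "0 < \<theta>" and z: "z \<in> Hs l 4"
    and unit: "\<And>s. s \<in> {0<..<l} \<Longrightarrow> norm (dval l 1 z s) = 1"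
    and bc: "dval l 1 z 0 = e2" "dval l 1 z l = bvec \<theta>"
  shows "integral {0..l} (\<lambda>s. (norm (dval l 2 p s))\<^sup>2) - (1 / R\<^sup>2) * integral {0..l} (\<lambda>s. (norm (dval l 1 p s))\<^sup>2)
      = integral {0..l} (\<lambda>s. (norm (dval l 2 z s))\<^sup>2) - (1 / R\<^sup>2) * l" (is ?excess)
    and "(1 / R\<^sup>2) * integral {0..l} (\<lambda>s. (norm (dval l 1 p s))\<^sup>2)
      \<le> (\<theta>\<^sup>2 / pi\<^sup>2) * integral {0..l} (\<lambda>s. (norm (dval l 2 p s))\<^sup>2)" (is ?poincare)
    and "integral {0..l} (\<lambda>s. (norm (dval l 2 p s))\<^sup>2) = 0 \<Longrightarrow> s \<in> {0..l} \<Longrightarrow> dval l 1 p s = 0"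
proof -
  have l: "l > 0" using R \<theta> by (simp add: l_def)
  have p: "p \<in> Hs l 4" and dp: "\<And>k s. k < 4 \<Longrightarrow> s \<in> {0..l} \<Longrightarrow> dval l k p s = dval l k z s - arc_deriv R t k s"
    using arc_perturbation(1,2)[OF R \<theta> z[unfolded l_def], where t = t] unfolding l_def p_def by blast+
  have der: "(dval l 1 f has_vector_derivative dval l 2 f s) (at s within {0..l})"
    if "f \<in> Hs l 4" "s \<in> {0..l}" for f :: "real \<Rightarrow> real^3" and s
    using dval_has_vector_derivative[OF l that(1) _ that(2), of 1] by (simp add: numeral_eq_Suc)
  have cont: "continuous_on {0..l} (dval l k f)" if "f \<in> Hs l 4" "k < 4" for f :: "real \<Rightarrow> real^3" and k
    by (rule dval_continuous[OF l that])
  have ends: "arc_deriv R t 1 0 = e2" "arc_deriv R t 1 l = bvec \<theta>"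
    using R unfolding arc_deriv_1[OF R] by (simp_all add: e2_def bvec_def l_def)
  have n\<tau>: "norm (arc_deriv R t 1 s) = 1" for s
    unfolding norm_eq_1 arc_deriv_1[OF R] inner_vector_3
    by (simp add: power2_eq_square[symmetric])
  have n\<kappa>: "(norm (arc_deriv R t 2 s))\<^sup>2 = 1 / R\<^sup>2" for s
    unfolding power2_norm_eq_inner arc_deriv_2[OF R] inner_vector_3
    using sin_cos_squared_add[of "s / R"]
    by (simp add: power2_eq_square add_divide_distrib[symmetric] add.commute)
  have \<tau>: "(arc_deriv R t 1 has_vector_derivative arc_deriv R t 2 s) (at s within {0..l})" for s
    using arc_deriv_has_vector_derivative[OF R, of t 1 s] by (auto simp: numeral_2_eq_2 intro: has_vector_derivative_at_within)
  have \<kappa>: "(arc_deriv R t 2 has_vector_derivative - (1 / R\<^sup>2) *\<^sub>R arc_deriv R t 1 s) (at s within {0..l})" for s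
    using arc_deriv_has_vector_derivative[OF R, of t 2 s] arc_deriv_3[OF R, of t s]
    by (auto simp: numeral_2_eq_2 numeral_3_eq_3 intro: has_vector_derivative_at_within)
  have unit': "norm (dval l 1 z s) = 1" if "s \<in> {0..l}" for s
    using that unit[of s] bc n\<tau>[of 0] n\<tau>[of l] ends by (cases "s = 0 \<or> s = l") auto
  have "integral {0..l} (\<lambda>s. (norm (dval l 2 z s - arc_deriv R t 2 s))\<^sup>2) -
      (1 / R\<^sup>2) * integral {0..l} (\<lambda>s. (norm (dval l 1 z s - arc_deriv R t 1 s))\<^sup>2)
      = integral {0..l} (\<lambda>s. (norm (dval l 2 z s))\<^sup>2) - (1 / R\<^sup>2) * l"
    by (rule excess_energy[OF l der[OF z] \<tau> \<kappa> cont[OF z] unit' n\<tau> n\<kappa>])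
       (simp_all add: bc ends del: One_nat_def)
  moreover have I: "integral {0..l} (\<lambda>s. (norm (dval l k p s))\<^sup>2) =
     integral {0..l} (\<lambda>s. (norm (dval l k z s - arc_deriv R t k s))\<^sup>2)" if "k < 4" for k
    using dp[OF that] by (intro integral_cong) simp
  ultimately show ?excess by (simp only: I)
  have "dval l 1 p 0 = dval l 1 z 0 - arc_deriv R t 1 0" "dval l 1 p l = dval l 1 z l - arc_deriv R t 1 l"
    using l by (intro dp; simp)+
  then have bcp: "dval l 1 p 0 = 0" "dval l 1 p l = 0"
    by (simp_all only: bc ends diff_self)
  have W: "(pi / l)\<^sup>2 * integral {0..l} (\<lambda>s. (norm (dval l 1 p s))\<^sup>2) \<le> integral {0..l} (\<lambda>s. (norm (dval l 2 p s))\<^sup>2)"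
    by (rule wirtinger[OF l der[OF p] cont[OF p] bcp]) simp_all
  have "(\<theta>\<^sup>2 / pi\<^sup>2) * ((pi / l)\<^sup>2 * integral {0..l} (\<lambda>s. (norm (dval l 1 p s))\<^sup>2))
      \<le> (\<theta>\<^sup>2 / pi\<^sup>2) * integral {0..l} (\<lambda>s. (norm (dval l 2 p s))\<^sup>2)"
    by (intro mult_left_mono W) simp
  moreover have "(\<theta>\<^sup>2 / pi\<^sup>2) * ((pi / l)\<^sup>2 * c) = (1 / R\<^sup>2) * c" for c
    using R \<theta> by (simp add: l_def field_simps power2_eq_square)
  ultimately show ?poincare by simp
  assume "integral {0..l} (\<lambda>s. (norm (dval l 2 p s))\<^sup>2) = 0" and s: "s \<in> {0..l}"
  with W have "(pi / l)\<^sup>2 * integral {0..l} (\<lambda>s. (norm (dval l 1 p s))\<^sup>2) \<le> 0"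
    by simp
  moreover have "(pi / l)\<^sup>2 > 0" using l by simp
  ultimately have "integral {0..l} (\<lambda>s. (norm (dval l 1 p s))\<^sup>2) \<le> 0"
    by (metis mult_le_0_iff not_less order_less_imp_le)
  moreover have c1: "continuous_on {0..l} (\<lambda>s. (norm (dval l 1 p s))\<^sup>2)"
    by (intro continuous_intros cont p) simp
  moreover have "0 \<le> integral {0..l} (\<lambda>s. (norm (dval l 1 p s))\<^sup>2)"
    by (intro integral_nonneg integrable_continuous_real c1) simp
  ultimately have "\<forall>s\<in>{0..l}. (norm (dval l 1 p s))\<^sup>2 = 0"
    using integral_eq_0_iff[OF c1 l] by simp
  then show "dval l 1 p s = 0" using s by simp
qed

section \<open>Perturbations of the arc do not decay\<close>

theorem lemma3p2:
  fixes R \<theta> :: real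
    and \<phi>0 :: "real \<Rightarrow> real^3"
    and x \<phi> :: "real \<Rightarrow> real \<Rightarrow> real^3"
  assumes "R > 0" and "0 < \<theta>" and "\<theta> < pi"
    and "\<phi>0 \<in> Hs (\<theta> * R) 4"
    and A1: "unit_speed_datum R \<theta> \<phi>0"
    and A2: "compatible_datum R \<theta> \<phi>0"
    and A3: "normal_datum R \<theta> \<phi>0"
    and sol: "solves_P R \<theta> \<phi>0 x" "solution_class (\<theta> * R) x"
    and \<phi>_eq: "\<phi> = (\<lambda>t s. x t s - arc_filament R t s)"
  shows
    "((\<exists>c. \<forall>s\<in>{0<..<\<theta> * R}. ptval (\<theta> * R) \<phi>0 s = c) \<longrightarrow>
        (\<forall>t>0. \<forall>s\<in>{0<..<\<theta> * R}. ptval (\<theta> * R) (\<phi> t) s = ptval (\<theta> * R) \<phi>0 s) \<and>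
        (\<forall>t>0. L2norm (\<theta> * R) (wderiv (\<theta> * R) 2 (\<phi> t)) = 0)) \<and>
     ((\<nexists>c. \<forall>s\<in>{0<..<\<theta> * R}. ptval (\<theta> * R) \<phi>0 s = c) \<longrightarrow>
        L2norm (\<theta> * R) (wderiv (\<theta> * R) 2 \<phi>0) > 0 \<and>
        (\<forall>t>0. L2norm (\<theta> * R) (wderiv (\<theta> * R) 2 (\<phi> t)) \<ge>
               sqrt (1 - \<theta>\<^sup>2 / pi\<^sup>2) * L2norm (\<theta> * R) (wderiv (\<theta> * R) 2 \<phi>0))) \<and>
     ((\<forall>t>0. L2norm (\<theta> * R) (wderiv (\<theta> * R) 2 (\<phi> t)) = 0) \<or>
      (\<forall>t>0. L2norm (\<theta> * R) (wderiv (\<theta> * R) 2 (\<phi> t)) > 0)) \<and>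
     ((\<exists>s\<in>{0<..<\<theta> * R}. ptval (\<theta> * R) \<phi>0 s \<noteq> 0) \<longrightarrow>
        \<not> ((\<lambda>t. Hnorm (\<theta> * R) 2 (\<phi> t)) \<longlongrightarrow> 0) at_top)"
proof -
  define l where "l = \<theta> * R"
  have l: "l > 0" using \<open>R > 0\<close> \<open>0 < \<theta>\<close> by (simp add: l_def)
  note R = \<open>R > 0\<close>
  have \<phi>0H: "\<phi>0 \<in> Hs l 4" using assms(4) by (simp add: l_def)
  have xc: "time_cont l 4 x"
    using sol(2) unfolding solution_class_def l_def[symmetric] by (auto dest: spec[of _ 0])
  then have xH: "x t \<in> Hs l 4" if "t \<ge> 0" for t
    using that by (simp add: time_cont_def)
  have "time_Ck l 2 (Suc 0) x"
    using sol(2) unfolding solution_class_def l_def[symmetric] by (auto dest: spec[of _ 1])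
  then obtain v where v: "\<And>t. t \<ge> 0 \<Longrightarrow> has_time_deriv l 2 x (v t) t"
    by auto
  have eqn: "dval l 0 (v t) s = cross3 (dval l 1 (x t) s) (dval l 2 (x t) s)" if "t > 0" "s \<in> {0<..<l}" for t s
  proof -
    have "v t \<in> L2 l" using v[of t] that by (simp add: has_time_deriv_def Hs_def)
    then have "dval l 0 (v t) s = ptval l (tderiv l x t) s"
      using ptval_tderiv[OF v, of t] that by (simp add: dval_0)
    also have "\<dots> = cross3 (dval l 1 (x t) s) (dval l 2 (x t) s)"
      using sol(1) that unfolding solves_P_def Let_def l_def[symmetric] by blast
    finally show ?thesis .
  qed
  have ptx: "dval l 0 f = ptval l f" if "f \<in> Hs l 4" for f :: "real \<Rightarrow> real^3"
    by (rule dval_0) (use that in \<open>simp add: Hs_def\<close>)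
  have arc0: "arc_filament R 0 = arc_filament0 R"
    by (simp add: fun_eq_iff arc_filament_def arc_filament0_def)
  have arc0H: "arc_filament0 R \<in> Hs l 4"
    using arc_filament_Hs[OF R l, of 0] by (simp add: arc0)
  define x0 where "x0 = (\<lambda>s. arc_filament0 R s + \<phi>0 s)"
  have x0H: "x0 \<in> Hs l 4" unfolding x0_def by (rule Hs_add[OF arc0H \<phi>0H])
  have init: "AE s in lebesgue_on {0<..<l}. x 0 s = x0 s"
  proof -
    have "AE s in lebesgue_on {0<..<l}. ptval l (x 0) s = x 0 s" "AE s in lebesgue_on {0<..<l}. ptval l \<phi>0 s = \<phi>0 s"
      by (rule ptval_AE[OF l xH[of 0]] ptval_AE[OF l \<phi>0H]; simp)+
    moreover have "AE s in lebesgue_on {0<..<l}. ptval l (x 0) s = arc_filament0 R s + ptval l \<phi>0 s"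
      using sol(1) unfolding solves_P_def Let_def l_def[symmetric] by (intro AE_I2) simp
    ultimately show ?thesis
      unfolding x0_def by eventually_elim simp
  qed
  have wd_init: "wderiv l k (x 0) = wderiv l k x0" for k
    by (rule wderiv_cong_AE[OF init]) (use xH[of 0] x0H in \<open>auto simp: Hs_def L2_def\<close>)
  have bc: "dval l 1 (x t) 0 = e2" "dval l 1 (x t) l = bvec \<theta>" if "t \<ge> 0" for t
  proof -
    have "dval l 1 x0 0 = e2 \<and> dval l 1 x0 l = bvec \<theta>"
      using A2 unfolding compatible_datum_def Let_def l_def[symmetric] x0_def by blast
    then have "dval l 1 (x 0) 0 = e2 \<and> dval l 1 (x 0) l = bvec \<theta>" by (simp only: wd_init)
    moreover have "dval l 1 (x t) 0 = e2 \<and> dval l 1 (x t) l = bvec \<theta>" if "t > 0"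
      using sol(1) that unfolding solves_P_def Let_def l_def[symmetric] by blast
    ultimately show "dval l 1 (x t) 0 = e2" "dval l 1 (x t) l = bvec \<theta>"
      using that by (cases "t = 0"; simp)+
  qed
  have unit: "norm (dval l 1 (x t) s) = 1" if "t \<ge> 0" "s \<in> {0<..<l}" for t s
  proof (cases "t = 0")
    case True
    have "dval l 1 (x t) s = dval l 1 (arc_filament0 R) s + dval l 1 \<phi>0 s"
      unfolding True wd_init x0_def by (rule dval_add[OF arc0H \<phi>0H l]) (use that in auto)
    then show ?thesis
      using A1 that unfolding unit_speed_datum_def l_def[symmetric] by simp
  next
    case False
    then show ?thesis
      using sol(2) that unfolding solution_class_def l_def[symmetric] by simp
  qed
  have \<phi>t: "\<phi> t = (\<lambda>s. x t s - arc_filament R t s)" for t by (simp add: \<phi>_eq)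
  have \<phi>H: "\<phi> t \<in> Hs l 4" and
    d\<phi>: "\<And>k s. k < 4 \<Longrightarrow> s \<in> {0..l} \<Longrightarrow> dval l k (\<phi> t) s = dval l k (x t) s - arc_deriv R t k s" and
    L2\<phi>: "\<And>k. k < 4 \<Longrightarrow> (L2norm l (wderiv l k (\<phi> t)))\<^sup>2 = integral {0..l} (\<lambda>s. (norm (dval l k (\<phi> t) s))\<^sup>2)"
    if "t \<ge> 0" for t
    using arc_perturbation[OF R \<open>0 < \<theta>\<close> xH[OF that, unfolded l_def], where t = t] unfolding l_def \<phi>t by blast+
  have "AE s in lebesgue_on {0<..<l}. \<phi> 0 s = \<phi>0 s"
    using init by eventually_elim (simp add: \<phi>t x0_def arc0)
  then have wd_\<phi>0: "wderiv l k (\<phi> 0) = wderiv l k \<phi>0" for k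
    by (rule wderiv_cong_AE) (use \<phi>H[of 0] \<phi>0H in \<open>auto simp: Hs_def L2_def\<close>)
  define N where "N t = integral {0..l} (\<lambda>s. (norm (dval l 2 (\<phi> t) s))\<^sup>2)" for t
  define M where "M t = integral {0..l} (\<lambda>s. (norm (dval l 1 (\<phi> t) s))\<^sup>2)" for t
  have energy: "N t - (1 / R\<^sup>2) * M t = integral {0..l} (\<lambda>s. (norm (dval l 2 (x t) s))\<^sup>2) - (1 / R\<^sup>2) * l"
    and poincare: "(1 / R\<^sup>2) * M t \<le> \<theta>\<^sup>2 / pi\<^sup>2 * N t"
    and rigid: "N t = 0 \<Longrightarrow> s \<in> {0..l} \<Longrightarrow> dval l 1 (\<phi> t) s = 0" if "t \<ge> 0" for t s
    unfolding N_def M_def \<phi>t l_def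
    by (rule arc_perturbation_energy[OF R \<open>0 < \<theta>\<close> xH[OF that, unfolded l_def] unit[OF that, unfolded l_def]
          bc(1)[OF that, unfolded l_def] bc(2)[OF that, unfolded l_def]]; assumption)+
  have N: "L2norm l (wderiv l 2 (\<phi> t)) = sqrt (N t)" if "t \<ge> 0" for t
    using L2\<phi>[OF that, of 2] by (simp add: N_def real_sqrt_unique L2norm_def)
  have N0: "L2norm l (wderiv l 2 \<phi>0) = sqrt (N 0)"
    using N[of 0] by (simp add: wd_\<phi>0)
  have Npos: "0 \<le> N t" if "t \<ge> 0" for t
    using L2\<phi>[OF that, of 2] by (simp add: N_def) (metis zero_le_power2)
  have Mpos: "0 \<le> M t" if "t \<ge> 0" for t
    using L2\<phi>[OF that, of 1] by (simp add: M_def) (metis zero_le_power2)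
  have conserved: "N t - (1 / R\<^sup>2) * M t = N 0 - (1 / R\<^sup>2) * M 0" if "t \<ge> 0" for t
  proof -
    have "integral {0..l} (\<lambda>s. (norm (dval l 2 (x t) s))\<^sup>2) = integral {0..l} (\<lambda>s. (norm (dval l 2 (x 0) s))\<^sup>2)"
      by (rule energy_conserved[OF l xc v bc eqn that]) auto
    then show ?thesis
      using energy[OF that] energy[of 0] by simp
  qed
  have \<theta>: "\<theta>\<^sup>2 / pi\<^sup>2 < 1"
    using \<open>0 < \<theta>\<close> \<open>\<theta> < pi\<close> by (simp add: power_strict_mono)
  \<comment> \<open>\<open>N - M / R\<^sup>2\<close> is conserved and lies between \<open>(1 - \<theta>\<^sup>2 / \<pi>\<^sup>2) N\<close> and \<open>N\<close>.\<close>
  have lower: "(1 - \<theta>\<^sup>2 / pi\<^sup>2) * N 0 \<le> N t" if "t \<ge> 0" for t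
  proof -
    have "0 \<le> (1 / R\<^sup>2) * M t" using Mpos[OF that] by simp
    with conserved[OF that] poincare[of 0] show ?thesis
      unfolding left_diff_distrib by linarith
  qed
  have upper: "(1 - \<theta>\<^sup>2 / pi\<^sup>2) * N t \<le> N 0" if "t \<ge> 0" for t
  proof -
    have "0 \<le> (1 / R\<^sup>2) * M 0" using Mpos[of 0] by simp
    with conserved[OF that] poincare[OF that] show ?thesis
      unfolding left_diff_distrib by linarith
  qed
  have const_iff: "(\<exists>c. \<forall>s\<in>{0<..<l}. ptval l \<phi>0 s = c) \<longleftrightarrow> N 0 = 0"
  proof
    assume "\<exists>c. \<forall>s\<in>{0<..<l}. ptval l \<phi>0 s = c"
    then obtain c where c: "\<And>s. s \<in> {0<..<l} \<Longrightarrow> dval l 0 \<phi>0 s = c"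
      using ptx[OF \<phi>0H] by auto
    have 1: "dval l (Suc 0) \<phi>0 s = 0" if "s \<in> {0..l}" for s
      by (rule dval_Suc_eq_0[OF l \<phi>0H _ c that]) auto
    have "dval l (Suc (Suc 0)) \<phi>0 s = 0" if "s \<in> {0..l}" for s
      by (rule dval_Suc_eq_0[OF l \<phi>0H _ _ that, of "Suc 0" 0]) (auto simp: 1)
    then have "N 0 = integral {0..l} (\<lambda>s. 0)"
      unfolding N_def wd_\<phi>0 by (intro integral_cong) (simp add: numeral_2_eq_2)
    then show "N 0 = 0" by simp
  next
    assume "N 0 = 0"
    then have "dval l 1 (\<phi> 0) s = 0" if "s \<in> {0..l}" for s
      using rigid[of 0 s] that by simp
    then obtain c where "\<forall>s\<in>{0..l}. dval l 0 \<phi>0 s = c"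
      using dval_const[OF l \<phi>0H, of 0] by (auto simp: wd_\<phi>0)
    then show "\<exists>c. \<forall>s\<in>{0<..<l}. ptval l \<phi>0 s = c"
      using ptx[OF \<phi>0H] by (intro exI[of _ c]) auto
  qed
  have stationary: "N t = 0 \<and> (\<forall>s\<in>{0<..<l}. ptval l (\<phi> t) s = ptval l \<phi>0 s)" if N00: "N 0 = 0" and t: "t > 0" for t
  proof -
    have Nt: "N t = 0" if "t \<ge> 0" for t
      using upper[OF that] Npos[OF that] \<theta> N00 by (simp add: mult_le_0_iff)
    have u: "dval l 1 (\<phi> t) s = 0" if "t \<ge> 0" "s \<in> {0..l}" for t s
      using rigid[of t s] that Nt by simp
    have w: "dval l 2 (\<phi> t) s = 0" if "t \<ge> 0" "s \<in> {0..l}" for t s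
      using dval_Suc_eq_0[OF l \<phi>H[OF that(1)], of 1 0 s] u[OF that(1)] that(2) by (simp add: numeral_2_eq_2)
    \<comment> \<open>The filament moves with the velocity of the arc, the constant \<open>\<tau> \<times> \<tau>\<^sub>s\<close>.\<close>
    have vt: "dval l 0 (v t) s = vector [0, 0, 1 / R]" if "t > 0" "s \<in> {0<..<l}" for t s
    proof -
      have "dval l 1 (x t) s = arc_deriv R t 1 s" "dval l 2 (x t) s = arc_deriv R t 2 s"
        using u[of t s] w[of t s] d\<phi>[of t 1 s] d\<phi>[of t 2 s] that by simp_all
      then show ?thesis
        using eqn[OF that] cross3_arc_deriv[OF R, of t s] by simp
    qed
    have "ptval l (\<phi> t) s = ptval l \<phi>0 s" if s: "s \<in> {0<..<l}" for s
    proof -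
      have s': "s \<in> {0..l}" using s by auto
      have "dval l 0 (x t) s = dval l 0 (x 0) s + t *\<^sub>R vector [0, 0, 1 / R]"
        by (rule constant_time_deriv[OF l xc v _ _ s' vt[OF _ s] t]) auto
      moreover have "arc_deriv R t 0 s = arc_deriv R 0 0 s + t *\<^sub>R vector [0, 0, 1 / R]"
        by (simp add: arc_deriv_0 arc_filament_def vec_eq_iff forall_3)
      ultimately have "dval l 0 (\<phi> t) s = dval l 0 (\<phi> 0) s"
        using d\<phi>[of t 0 s] d\<phi>[of 0 0 s] t s' by simp
      then show ?thesis
        using t by (simp add: wd_\<phi>0 ptx \<phi>H \<phi>0H)
    qed
    then show ?thesis using Nt t by simp
  qed
  have no_decay: "\<not> ((\<lambda>t. Hnorm l 2 (\<phi> t)) \<longlongrightarrow> 0) at_top" if s: "s \<in> {0<..<l}" "ptval l \<phi>0 s \<noteq> 0" for s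
  proof
    assume lim: "((\<lambda>t. Hnorm l 2 (\<phi> t)) \<longlongrightarrow> 0) at_top"
    show False
    proof (cases "N 0 = 0")
      case True
      \<comment> \<open>The perturbation is a fixed nonzero vector, which its norm in \<open>H\<^sup>2\<close> controls at \<open>s\<close>.\<close>
      have "norm (ptval l \<phi>0 s) \<le> sqrt (2 / l + 2 * l) * Hnorm l 2 (\<phi> t)" if "t > 0" for t
      proof -
        have "norm (dval l 0 (\<phi> t) s) \<le> sqrt (2 / l + 2 * l) * Hnorm l 2 (\<phi> t)"
          using that s by (intro sobolev_embedding l Hs_mono[OF \<phi>H]) auto
        then show ?thesis
          using stationary[OF True that] s that by (simp add: ptx \<phi>H)
      qed
      then have "\<forall>\<^sub>F t in at_top. norm (ptval l \<phi>0 s) \<le> sqrt (2 / l + 2 * l) * Hnorm l 2 (\<phi> t)"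
        by (intro eventually_mono[OF eventually_gt_at_top[of "0 :: real"]]) blast
      moreover have "((\<lambda>t. sqrt (2 / l + 2 * l) * Hnorm l 2 (\<phi> t)) \<longlongrightarrow> sqrt (2 / l + 2 * l) * 0) at_top"
        by (intro tendsto_intros lim)
      ultimately have "norm (ptval l \<phi>0 s) \<le> sqrt (2 / l + 2 * l) * 0"
        by (intro tendsto_lowerbound) auto
      then show False using s by simp
    next
      case False
      have "(1 - \<theta>\<^sup>2 / pi\<^sup>2) * N 0 \<le> (Hnorm l 2 (\<phi> t))\<^sup>2" if "t > 0" for t
        using lower[of t] L2norm_le_Hnorm[of 2 2 l "\<phi> t"] L2\<phi>[of t 2] that by (simp add: N_def)
      then have "\<forall>\<^sub>F t in at_top. (1 - \<theta>\<^sup>2 / pi\<^sup>2) * N 0 \<le> (Hnorm l 2 (\<phi> t))\<^sup>2"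
        by (intro eventually_mono[OF eventually_gt_at_top[of "0 :: real"]]) blast
      moreover have "((\<lambda>t. (Hnorm l 2 (\<phi> t))\<^sup>2) \<longlongrightarrow> 0\<^sup>2) at_top"
        by (intro tendsto_intros lim)
      ultimately have "(1 - \<theta>\<^sup>2 / pi\<^sup>2) * N 0 \<le> 0\<^sup>2"
        by (intro tendsto_lowerbound) auto
      then show False
        using False Npos[of 0] \<theta> by (simp add: mult_le_0_iff)
    qed
  qed
  have bound: "sqrt (1 - \<theta>\<^sup>2 / pi\<^sup>2) * sqrt (N 0) \<le> sqrt (N t)" if "t > 0" for t
    using lower[of t] that by (simp add: real_sqrt_mult[symmetric] real_sqrt_le_mono)
  have pos: "0 < N 0" if "N 0 \<noteq> 0"
    using Npos[of 0] that by simp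
  have posT: "0 < N t" if "N 0 \<noteq> 0" "t > 0" for t
  proof -
    have "0 < (1 - \<theta>\<^sup>2 / pi\<^sup>2) * N 0"
      using \<theta> by (intro mult_pos_pos pos[OF that(1)]) linarith
    also have "\<dots> \<le> N t" using that by (intro lower) simp
    finally show ?thesis .
  qed
  show ?thesis
    unfolding l_def[symmetric] const_iff N0
  proof (intro conjI)
    show "(\<exists>s\<in>{0<..<l}. ptval l \<phi>0 s \<noteq> 0) \<longrightarrow> \<not> ((\<lambda>t. Hnorm l 2 (\<phi> t)) \<longlongrightarrow> 0) at_top"
      using no_decay by blast
  qed (use stationary bound pos posT N in \<open>cases "N 0 = 0"; simp\<close>)+
qed

end
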